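(* Let $n\ge 4$ and assume that the equation $F(a)=0$ has exactly two positive solutions, denoted $z_1<z_2$. Then the set of admissible values for twisted $(2,n)$-crowns is $$\mathcal{A}_2(n)=(0,1/z_2)\cup(z_1,1/z_1)\cup(z_2,\infty).$$
   Context: Let $n\ge 2$ be an integer. For $a>0$ and $m>0$ consider $2n$ bodies in the plane $\mathbb{R}^2\cong\mathbb{C}$: $n$ bodies of mass $1$ at the points $e^{2\pi i k/n}$, $k=0,\dots,n-1$, and $n$ bodies of mass $m$ at the points $a\,e^{i(\pi/n+2\pi k/n)}$, $k=0,\dots,n-1$. The center of mass is at the origin. Configuration $(q_i)$ with masses $(\mu_i)$ is a central configuration if there is $\lambda\in\mathbb{R}$ such that $\nabla_{q_i}U+\lambda\mu_i q_i=0$ for all $i$, where $U=\sum_{i<j}\mu_i\mu_j/\|q_i-q_j\|$. If the configuration of $2n$ bodies consisting of $n$ bodies of mass $1$ at the points $e^{2\pi i k/n}$ and $n$ bodies of mass $m$ at the points $a\,e^{i(\pi/n+2\pi k/n)}$, $k=0,\dots,n-1$, is central, it is called a twisted $(2,n)$-crown with radius $a$ and mass ratio $m$. A value $a>0$ is admissible if there exists $m>0$ such that the configuration with parameters $(a,m)$ is a twisted $(2,n)$-crown; $\mathcal{A}_2(n)$ denotes the set of admissible values. Put $S_n=\frac14\sum_{k=1}^{n-1}\frac{1}{\sin(k\pi/n)}$, $\theta_k=(2k-1)\pi/n$, and $$C_{12}(a)=\sum_{k=1}^n\frac{1-a\cos\theta_k}{(1+a^2-2a\cos\theta_k)^{3/2}},\qquad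 C_{21}(a)=\sum_{k=1}^n\frac{a-\cos\theta_k}{(1+a^2-2a\cos\theta_k)^{3/2}},$$ $$F(a)=S_na-C_{21}(a),\qquad G(a)=S_n-a^3C_{12}(a),\qquad H(a)=a^2\frac{F(a)}{G(a)}.$$ The configuration with parameters $(a,m)$ is a twisted $(2,n)$-crown if and only if $(C_{21}(a)-S_na)+\left(\frac{S_n}{a^2}-aC_{12}(a)\right)m=0$, that is, $m=H(a)$ when $G(a)\neq0$. *)

theory Defs
  imports "HOL-Analysis.Analysis"
begin

definition potential :: "nat \<Rightarrow> (nat \<Rightarrow> real) \<Rightarrow> (nat \<Rightarrow> complex) \<Rightarrow> real" where
  "potential N \<mu> q = (\<Sum>j<N. \<Sum>i<j. \<mu> i * \<mu> j / norm (q i - q j))"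

text \<open>The plane is the real inner product space of complex numbers. \<open>GDERIV\<close> is the
  gradient for its inner product; here it is taken in the position of body \<open>i\<close> only, the
  other bodies staying fixed. The potential is only meaningful off collisions (division by
  zero yields zero), so the positions are required to be distinct.\<close>

definition central_configuration :: "nat \<Rightarrow> (nat \<Rightarrow> real) \<Rightarrow> (nat \<Rightarrow> complex) \<Rightarrow> bool" where
  "central_configuration N \<mu> q \<longleftrightarrow>
     inj_on q {..<N} \<and>
     (\<exists>l::real. \<forall>i<N. \<exists>g::complex.
        GDERIV (\<lambda>x. potential N \<mu> (q(i := x))) (q i) :> g \<and>
        g + (l * \<mu> i) *\<^sub>R q i = 0)"

text \<open>Indices below \<open>n\<close> are the bodies on the unit circle, indices from \<open>n\<close> to \<open>2 * n - 1\<close>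
  those on the rotated ring of radius \<open>a\<close>.\<close>

definition crown_position :: "nat \<Rightarrow> real \<Rightarrow> nat \<Rightarrow> complex" where
  "crown_position n a i =
     (if i < n then cis (2 * pi * real i / real n)
      else of_real a * cis (pi / real n + 2 * pi * real (i - n) / real n))"

definition crown_mass :: "nat \<Rightarrow> real \<Rightarrow> nat \<Rightarrow> real" where
  "crown_mass n m i = (if i < n then 1 else m)"

definition twisted_crown :: "nat \<Rightarrow> real \<Rightarrow> real \<Rightarrow> bool" where
  "twisted_crown n a m \<longleftrightarrow>
     central_configuration (2 * n) (crown_mass n m) (crown_position n a)"

definition admissible :: "nat \<Rightarrow> real set" where
  "admissible n = {a. a > 0 \<and> (\<exists>m>0. twisted_crown n a m)}"

definition S :: "nat \<Rightarrow> real" where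
  "S n = (1 / 4) * (\<Sum>k = 1..n - 1. 1 / sin (real k * pi / real n))"

definition \<theta> :: "nat \<Rightarrow> nat \<Rightarrow> real" where
  "\<theta> n k = (2 * real k - 1) * pi / real n"

definition C21 :: "nat \<Rightarrow> real \<Rightarrow> real" where
  "C21 n a = (\<Sum>k = 1..n. (a - cos (\<theta> n k)) /
                 (1 + a\<^sup>2 - 2 * a * cos (\<theta> n k)) powr (3 / 2))"

definition F :: "nat \<Rightarrow> real \<Rightarrow> real" where
  "F n a = S n * a - C21 n a"

end

theory Submission
  imports Defs
begin

text \<open>Reflection and rotation symmetry reduce the \<open>2 * n\<close> vector equations of a central
configuration to two scalar ones, one for each ring, and eliminating the multiplier leaves
\<open>m * F n (1 / a) = a * F n a\<close> (\<open>twisted_crown_iff\<close>). Inversion of the radius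
exchanges the rings, and \<open>F n (1 / a)\<close> stands for \<open>(S n - a ^ 3 * C12 n a) / a\<close>. Hence
\<open>a\<close> is admissible exactly when \<open>F n a\<close> and \<open>F n (1 / a)\<close> have the same sign, zero included,
and everything depends on the sign of \<open>F n\<close> and on the order of \<open>z1\<close>, \<open>z2\<close> and
their inverses. The claimed set results if \<open>F n\<close> is negative exactly between its zeros, \<open>z1 < 1\<close>,
and \<open>z1 * z2 > 1\<close>.

The last inequality is the delicate one: if \<open>z2\<close> were \<open>1 / z1\<close>, then \<open>z1\<close> itself would be
admissible. The zeros need not be located to prove it. One point \<open>b\<close> in \<open>(0, 1)\<close> with \<open>F n b > 0\<close>
and \<open>F n (1 / b) < 0\<close> is enough: as \<open>F n\<close> is negative at \<open>1\<close> and positive far out, it has a zero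
in \<open>(b, 1)\<close> and another one beyond \<open>1 / b\<close>; there are no others, so \<open>b < z1\<close> and
\<open>1 / b < z2\<close>. For \<open>n \<ge> 5\<close> the point \<open>b = cos (pi / n)\<close> works. It is the radius at which
the two nearest bodies of the other ring pull at a right angle to the radial direction, so that
they contribute nothing to \<open>C21\<close> and a lot to \<open>C12\<close> (\<open>F_changes_sign_at_cos\<close>). For \<open>n = 4\<close> the
point \<open>b = 2 / 3\<close> works (\<open>F_changes_sign_square\<close>).

The remaining bodies are treated by comparison with \<open>S n\<close>. With \<open>s = sin (\<theta> / 2)\<close> a term of
\<open>C21\<close> is at most \<open>1 / ((1 + b)\<^sup>2 * s)\<close> and one of \<open>C12\<close> is at least \<open>1 / (4 * s)\<close>
if \<open>1 - b \<le> 4 * s\<^sup>2\<close>. The sums of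
\<open>1 / s\<close> run over the midpoints between the multiples of \<open>pi / n\<close> that occur in \<open>S n\<close>, and a
sharpened convexity of \<open>1 / sin\<close> compares the two (\<open>S_le_midpoints\<close>, \<open>midpoints_le_S\<close>).\<close>

section \<open>The gradient of the potential\<close>

text \<open>The attraction that a unit mass at displacement \<open>z\<close> exerts. Its value at \<open>0\<close> is \<open>0\<close>, so sums of
forces may include the body on which they act.\<close>

definition newton :: "complex \<Rightarrow> complex" where
  "newton z = z /\<^sub>R norm z ^ 3"

lemma gderiv_inverse_distance:
  assumes "x \<noteq> p"
  shows "GDERIV (\<lambda>x. c / norm (x - p)) x :> c *\<^sub>R newton (p - x)"
proof -
  have 1: "GDERIV (\<lambda>x. norm (x - p)) x :> sgn (x - p)"
  proof -
    have shift: "((\<lambda>x. x - p) has_derivative (\<lambda>h. h)) (at x)"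
      by (auto intro!: derivative_eq_intros)
    have norm: "(norm has_derivative (\<lambda>h. inner h (sgn (x - p)))) (at (x - p))"
      using assms by (intro has_derivative_norm) simp
    from has_derivative_compose[OF shift norm]
    show ?thesis by (simp add: gderiv_def)
  qed
  have 2: "DERIV (\<lambda>r. c / r) (norm (x - p)) :> - c / (norm (x - p))\<^sup>2"
    using assms by (auto intro!: derivative_eq_intros simp: power2_eq_square)
  have "GDERIV (\<lambda>x. c / norm (x - p)) x :> (- c / (norm (x - p))\<^sup>2) *\<^sub>R sgn (x - p)"
    using GDERIV_DERIV_compose[OF 1 2] .
  moreover have "(- c / (norm (x - p))\<^sup>2) *\<^sub>R sgn (x - p) = c *\<^sub>R newton (p - x)"
  proof -
    have "newton (p - x) = - ((x - p) /\<^sub>R norm (x - p) ^ 3)"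
      unfolding newton_def by (simp add: norm_minus_commute flip: scaleR_minus_right)
    then show ?thesis
      by (simp add: sgn_div_norm divide_inverse power2_eq_square power3_eq_cube)
  qed
  ultimately show ?thesis by simp
qed

lemma GDERIV_unique:
  assumes "GDERIV f x :> g" "GDERIV f x :> g'"
  shows "g = g'"
proof -
  have "(\<lambda>h. inner h g) = (\<lambda>h. inner h g')"
    using assms has_derivative_unique unfolding gderiv_def by blast
  then have "inner (g - g') (g - g') = 0"
    by (metis inner_diff_right right_minus_eq)
  then show ?thesis by simp
qed

lemma GDERIV_sum:
  assumes "\<And>j. j \<in> A \<Longrightarrow> GDERIV (f j) x :> g j"
  shows "GDERIV (\<lambda>x. \<Sum>j\<in>A. f j x) x :> (\<Sum>j\<in>A. g j)"
  using assms unfolding gderiv_def inner_sum_right by (rule has_derivative_sum)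

text \<open>Only the pairs that contain \<open>i\<close> change when body \<open>i\<close> moves; isolating them turns the potential
into a single sum plus a constant.\<close>

lemma pair_sum_split:
  fixes w :: "nat \<Rightarrow> nat \<Rightarrow> real"
  assumes sym: "\<And>j k. w j k = w k j" and "i < N"
  shows "(\<Sum>j<N. \<Sum>k<j. w k j) =
    (\<Sum>j\<in>{..<N} - {i}. w i j) + (\<Sum>j\<in>{..<N} - {i}. \<Sum>k\<in>{..<j} - {i}. w k j)"
proof -
  have "(\<Sum>j<N. \<Sum>k<j. w k j) =
      (\<Sum>k<i. w k i) + (\<Sum>j\<in>{..<N} - {i}. \<Sum>k<j. w k j)"
    using \<open>i < N\<close> by (simp add: sum.remove[of "{..<N}" i])
  also have "(\<Sum>j\<in>{..<N} - {i}. \<Sum>k<j. w k j) =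
      (\<Sum>j\<in>{..<N} - {i}. (if i < j then w i j else 0) + (\<Sum>k\<in>{..<j} - {i}. w k j))"
    by (rule sum.cong) (auto simp: sum.remove[of _ i])
  also have "\<dots> = (\<Sum>j\<in>{..<N} - {i}. if i < j then w i j else 0)
      + (\<Sum>j\<in>{..<N} - {i}. \<Sum>k\<in>{..<j} - {i}. w k j)"
    by (rule sum.distrib)
  also have "(\<Sum>k<i. w k i) = (\<Sum>j\<in>{..<N} - {i}. if i < j then 0 else w i j)"
    using \<open>i < N\<close> sym by (intro sum.mono_neutral_cong_left) auto
  finally have "(\<Sum>j<N. \<Sum>k<j. w k j) =
      (\<Sum>j\<in>{..<N} - {i}. if i < j then 0 else w i j)
      + ((\<Sum>j\<in>{..<N} - {i}. if i < j then w i j else 0)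
      + (\<Sum>j\<in>{..<N} - {i}. \<Sum>k\<in>{..<j} - {i}. w k j))" .
  moreover have "(\<Sum>j\<in>{..<N} - {i}. if i < j then 0 else w i j)
      + (\<Sum>j\<in>{..<N} - {i}. if i < j then w i j else 0) = (\<Sum>j\<in>{..<N} - {i}. w i j)"
    by (subst sum.distrib[symmetric]) (rule sum.cong, auto)
  ultimately show ?thesis by simp
qed

lemma gderiv_potential:
  assumes inj: "inj_on q {..<N}" and "i < N"
  shows "GDERIV (\<lambda>x. potential N \<mu> (q(i := x))) (q i) :>
    \<mu> i *\<^sub>R (\<Sum>j\<in>{..<N} - {i}. \<mu> j *\<^sub>R newton (q j - q i))"
proof -
  define c where "c = (\<Sum>j\<in>{..<N} - {i}. \<Sum>k\<in>{..<j} - {i}. \<mu> k * \<mu> j / norm (q k - q j))"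
  have "potential N \<mu> (q(i := x)) = (\<Sum>j\<in>{..<N} - {i}. \<mu> i * \<mu> j / norm (x - q j)) + c" for x
  proof -
    have "potential N \<mu> (q(i := x)) =
      (\<Sum>j\<in>{..<N} - {i}. \<mu> i * \<mu> j / norm ((q(i := x)) i - (q(i := x)) j))
      + (\<Sum>j\<in>{..<N} - {i}. \<Sum>k\<in>{..<j} - {i}. \<mu> k * \<mu> j / norm ((q(i := x)) k - (q(i := x)) j))"
      unfolding potential_def
      by (rule pair_sum_split) (use \<open>i < N\<close> in \<open>simp_all add: mult.commute norm_minus_commute\<close>)
    then show ?thesis unfolding c_def by simp
  qed
  moreover have "GDERIV (\<lambda>x. (\<Sum>j\<in>{..<N} - {i}. \<mu> i * \<mu> j / norm (x - q j)) + c) (q i) :>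
      (\<Sum>j\<in>{..<N} - {i}. (\<mu> i * \<mu> j) *\<^sub>R newton (q j - q i)) + 0"
    using inj \<open>i < N\<close>
    by (intro GDERIV_add GDERIV_sum GDERIV_const gderiv_inverse_distance) (auto dest: inj_onD)
  ultimately show ?thesis by (simp add: scaleR_sum_right)
qed

text \<open>The mass \<open>\<mu> i\<close> is a common factor of the equation for body \<open>i\<close> and cancels.\<close>

lemma central_configuration_iff:
  assumes "\<And>i. i < N \<Longrightarrow> \<mu> i > 0"
  shows "central_configuration N \<mu> q \<longleftrightarrow> inj_on q {..<N} \<and>
    (\<exists>l::real. \<forall>i<N. (\<Sum>j<N. \<mu> j *\<^sub>R newton (q j - q i)) + l *\<^sub>R q i = 0)"
proof (cases "inj_on q {..<N}")
  case True
  have "(\<exists>g. GDERIV (\<lambda>x. potential N \<mu> (q(i := x))) (q i) :> g \<and> g + (l * \<mu> i) *\<^sub>R q i = 0)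
      \<longleftrightarrow> (\<Sum>j<N. \<mu> j *\<^sub>R newton (q j - q i)) + l *\<^sub>R q i = 0" (is "?L \<longleftrightarrow> ?A + _ = 0")
    if "i < N" for i l
  proof -
    have A: "?A = (\<Sum>j\<in>{..<N} - {i}. \<mu> j *\<^sub>R newton (q j - q i))"
      using that by (simp add: sum.remove[of "{..<N}" i] newton_def)
    have "?L \<longleftrightarrow> \<mu> i *\<^sub>R ?A + (l * \<mu> i) *\<^sub>R q i = 0"
      using gderiv_potential[OF True that, of \<mu>] GDERIV_unique unfolding A by blast
    also have "\<mu> i *\<^sub>R ?A + (l * \<mu> i) *\<^sub>R q i = \<mu> i *\<^sub>R (?A + l *\<^sub>R q i)"
      by (simp add: scaleR_add_right mult.commute)
    also have "\<dots> = 0 \<longleftrightarrow> ?A + l *\<^sub>R q i = 0"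
      using assms[OF that] by simp
    finally show ?thesis .
  qed
  then show ?thesis
    unfolding central_configuration_def using True by simp
qed (simp add: central_configuration_def)

section \<open>Forces in a twisted crown\<close>

definition C12 :: "nat \<Rightarrow> real \<Rightarrow> real" where
  "C12 n a = (\<Sum>k = 1..n. (1 - a * cos (\<theta> n k)) /
                 (1 + a\<^sup>2 - 2 * a * cos (\<theta> n k)) powr (3 / 2))"

lemma newton_cnj: "cnj (newton z) = newton (cnj z)"
  by (simp add: newton_def)

lemma newton_rotate: "norm u = 1 \<Longrightarrow> newton (u * z) = u * newton z"
  by (simp add: newton_def norm_mult)

lemma newton_dilate:
  assumes "a > 0"
  shows "newton (of_real a * z) = newton z /\<^sub>R a\<^sup>2"
proof -
  have "newton (of_real a * z) = (a * inverse (a ^ 3 * norm z ^ 3)) *\<^sub>R z"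
    using assms by (simp add: newton_def norm_mult power_mult_distrib scaleR_conv_of_real)
  also have "a * inverse (a ^ 3 * norm z ^ 3) = inverse (a\<^sup>2) * inverse (norm z ^ 3)"
    using assms by (simp add: power2_eq_square power3_eq_cube)
  finally show ?thesis by (simp add: newton_def)
qed

lemma theta_Suc: "\<theta> n (Suc k) = pi / real n + 2 * pi * real k / real n"
  by (simp add: \<theta>_def add_divide_distrib diff_divide_distrib algebra_simps)

text \<open>Describing the two rings by \<open>z ^ n = 1\<close> and \<open>z ^ n = - 1\<close> makes their symmetries algebraic:
multiplication by a root permutes or exchanges them and conjugation permutes each, which replaces
reindexing modulo \<open>n\<close>.\<close>

lemma bij_betw_roots_minus_one:
  assumes "n > 0"
  shows "bij_betw (\<lambda>k. cis (\<theta> n (Suc k))) {..<n} {z. z ^ n = - 1}"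
proof -
  have root: "cis (pi / real n) ^ n = - 1"
    using assms by (simp add: Complex.DeMoivre)
  have "bij_betw (\<lambda>z. cis (pi / real n) * z) {z. z ^ n = 1} {z. z ^ n = - 1}"
    by (rule bij_betwI[where g = "\<lambda>z. z / cis (pi / real n)"])
      (auto simp: power_mult_distrib power_divide root)
  from bij_betw_trans[OF Complex.bij_betw_roots_unity[OF assms] this]
  show ?thesis
    by (simp add: comp_def cis_mult theta_Suc)
qed

lemma norm_root_eq_1:
  fixes z :: complex
  assumes "n > 0" "z ^ n = 1 \<or> z ^ n = - 1"
  shows "norm z = 1"
proof -
  have "norm z ^ n = 1" using assms(2) by (metis norm_minus_cancel norm_one norm_power)
  then show ?thesis using assms(1) power_eq_1_iff[of "norm z" n] by simp
qed

text \<open>Multiplication by \<open>v\<close> carries the roots of unity onto the ring of \<open>v\<close>, and the force law commutes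
with rotations. So the force of a ring on one of its bodies is the same for all bodies up to
rotation, and the same for both rings.\<close>

lemma newton_sum_own_ring:
  fixes v :: complex
  assumes n: "n > 0" and v: "v ^ n = c" and c: "c = 1 \<or> c = - 1"
  shows "(\<Sum>z\<in>{z. z ^ n = c}. newton (z - v)) =
    v * (\<Sum>z\<in>{z. z ^ n = 1}. newton (z - 1))"
proof -
  have norm: "norm v = 1" using norm_root_eq_1[OF n] v c by blast
  then have "v \<noteq> 0" by auto
  have "(\<Sum>z\<in>{z. z ^ n = c}. newton (z - v)) =
      (\<Sum>z\<in>{z. z ^ n = 1}. newton (v * z - v))"
    using \<open>v \<noteq> 0\<close> v c
    by (intro sum.reindex_bij_witness[of _ "\<lambda>z. v * z" "\<lambda>z. z / v"])
      (auto simp: power_mult_distrib power_divide)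
  also have "\<dots> = (\<Sum>z\<in>{z. z ^ n = 1}. v * newton (z - 1))"
    using newton_rotate[OF norm] by (intro sum.cong refl) (metis mult.right_neutral right_diff_distrib)
  finally show ?thesis by (simp add: sum_distrib_left)
qed

text \<open>Division by \<open>v\<close> carries the ring opposite to \<open>v\<close> onto the ring \<open>z ^ n = - 1\<close>, for both
choices of the ring of \<open>v\<close>. The radii \<open>a\<close> and \<open>b\<close> let the statement serve for the force of
either ring on the other.\<close>

lemma newton_sum_other_ring:
  fixes v :: complex
  assumes n: "n > 0" and v: "v ^ n = - c" and c: "c = 1 \<or> c = - 1"
  shows "(\<Sum>z\<in>{z. z ^ n = c}. newton (of_real a * z - of_real b * v)) =
    v * (\<Sum>z\<in>{z. z ^ n = - 1}. newton (of_real a * z - of_real b))"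
proof -
  have norm: "norm v = 1" using norm_root_eq_1[OF n] v c by auto
  then have "v \<noteq> 0" by auto
  have "(\<Sum>z\<in>{z. z ^ n = c}. newton (of_real a * z - of_real b * v)) =
      (\<Sum>z\<in>{z. z ^ n = - 1}. newton (of_real a * (v * z) - of_real b * v))"
    using \<open>v \<noteq> 0\<close> v c
    by (intro sum.reindex_bij_witness[of _ "\<lambda>z. v * z" "\<lambda>z. z / v"])
      (auto simp: power_mult_distrib power_divide)
  also have "\<dots> = (\<Sum>z\<in>{z. z ^ n = - 1}. v * newton (of_real a * z - of_real b))"
  proof (intro sum.cong refl)
    fix z
    have "of_real a * (v * z) - of_real b * v = v * (of_real a * z - of_real b)"
      by (simp add: algebra_simps)
    then show "newton (of_real a * (v * z) - of_real b * v) = v * newton (of_real a * z - of_real b)"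
      using newton_rotate[OF norm] by simp
  qed
  finally show ?thesis by (simp add: sum_distrib_left)
qed

text \<open>Reflection in the axis through the attracted body permutes the attracting bodies, so the
components of the force across this axis cancel.\<close>

lemma newton_sum_real:
  assumes "\<And>z. z \<in> A \<Longrightarrow> cnj z \<in> A"
  shows "(\<Sum>z\<in>A. newton (of_real a * z - of_real b)) =
    of_real (\<Sum>z\<in>A. Re (newton (of_real a * z - of_real b)))"
proof -
  let ?f = "\<lambda>z. newton (of_real a * z - of_real b)"
  have "cnj (\<Sum>z\<in>A. ?f z) = (\<Sum>z\<in>A. ?f (cnj z))"
    unfolding cnj_sum newton_cnj by simp
  also have "\<dots> = (\<Sum>z\<in>A. ?f z)"
    by (rule sum.reindex_bij_witness[of _ cnj cnj]) (simp_all add: assms)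
  finally have "(\<Sum>z\<in>A. ?f z) \<in> \<real>"
    by (simp add: Reals_cnj_iff)
  from of_real_Re[OF this, symmetric] show ?thesis
    unfolding Re_sum .
qed

lemma square_powr_three_halves:
  fixes y :: real
  assumes "y \<ge> 0"
  shows "y\<^sup>2 powr (3 / 2) = y ^ 3"
proof -
  have "y\<^sup>2 powr (3 / 2) = (y powr 2) powr (3 / 2)"
    using assms by simp
  also have "\<dots> = y powr 3"
    by (simp only: powr_powr) simp
  also have "\<dots> = y ^ 3"
    using assms by (rule powr_numeral)
  finally show ?thesis .
qed

lemma newton_cis:
  "Re (newton (of_real a * cis t - of_real b)) =
    (a * cos t - b) / (a\<^sup>2 + b\<^sup>2 - 2 * a * b * cos t) powr (3 / 2)"
proof -
  let ?z = "of_real a * cis t - of_real b"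
  have "(norm ?z)\<^sup>2 = (a * cos t - b)\<^sup>2 + (a * sin t)\<^sup>2"
    by (simp add: cmod_power2)
  also have "\<dots> = a\<^sup>2 * ((cos t)\<^sup>2 + (sin t)\<^sup>2) + b\<^sup>2 - 2 * a * b * cos t"
    unfolding power2_eq_square by algebra
  finally have sq: "a\<^sup>2 + b\<^sup>2 - 2 * a * b * cos t = (norm ?z)\<^sup>2"
    by simp
  show ?thesis
    unfolding sq square_powr_three_halves[OF norm_ge_zero]
    by (simp add: newton_def divide_inverse mult.commute)
qed

text \<open>The chord from \<open>1\<close> to the \<open>k\<close>-th root of unity has length \<open>2 * sin (k * pi / n)\<close> and makes an
angle with the radial direction whose cosine is \<open>sin (k * pi / n)\<close>.\<close>

lemma newton_sum_roots_unity:
  assumes "n > 0"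
  shows "(\<Sum>z\<in>{z. z ^ n = 1}. newton (z - 1)) = - of_real (S n)"
proof -
  have entry: "Re (newton (cis (2 * pi * real k / real n) - 1)) = - (1 / sin (real k * pi / real n)) / 4"
    if "k < n" for k
  proof -
    define x where "x = real k * pi / real n"
    have "0 \<le> sin x"
      using that assms unfolding x_def by (intro sin_ge_zero) (auto simp: field_simps)
    have "Re (newton (cis (2 * x) - 1)) = (cos (2 * x) - 1) / (2 - 2 * cos (2 * x)) powr (3 / 2)"
      using newton_cis[of 1 "2 * x" 1] by simp
    also have "\<dots> = - 2 * (sin x)\<^sup>2 / ((2 * sin x)\<^sup>2) powr (3 / 2)"
      by (simp add: cos_double_sin power_mult_distrib)
    also have "\<dots> = - 2 * (sin x)\<^sup>2 / (2 * sin x) ^ 3"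
      using \<open>0 \<le> sin x\<close> by (subst square_powr_three_halves) auto
    also have "\<dots> = - (1 / sin x) / 4"
      by (simp add: power_mult_distrib power2_eq_square power3_eq_cube)
    finally show ?thesis
      by (simp add: x_def mult.commute mult.left_commute)
  qed
  have "(\<Sum>z\<in>{z. z ^ n = 1}. newton (z - 1)) =
      of_real (\<Sum>z\<in>{z. z ^ n = 1}. Re (newton (z - 1)))"
    using newton_sum_real[of "{z. z ^ n = 1}" 1 1] by (simp flip: complex_cnj_power)
  also have "(\<Sum>z\<in>{z. z ^ n = 1}. Re (newton (z - 1))) =
      (\<Sum>k<n. Re (newton (cis (2 * pi * real k / real n) - 1)))"
    by (rule sum.reindex_bij_betw[OF Complex.bij_betw_roots_unity[OF assms], symmetric])
  also have "\<dots> = (\<Sum>k<n. - (1 / sin (real k * pi / real n)) / 4)"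
    using entry by (intro sum.cong) auto
  also have "\<dots> = - (1 / 4) * (\<Sum>k<n. 1 / sin (real k * pi / real n))"
    by (simp add: sum_distrib_left sum_negf mult.commute)
  \<comment> \<open>the term for \<open>k = 0\<close> vanishes because division by zero yields zero\<close>
  also have "(\<Sum>k<n. 1 / sin (real k * pi / real n)) = (\<Sum>k = 1..n - 1. 1 / sin (real k * pi / real n))"
    using assms by (intro sum.mono_neutral_right) (auto simp: not_less_eq_eq)
  finally show ?thesis by (simp add: S_def)
qed

lemma newton_sum_roots_minus_one:
  assumes "n > 0"
  shows "(\<Sum>z\<in>{z. z ^ n = - 1}. newton (of_real a * z - of_real b)) =
    of_real (\<Sum>k = 1..n. (a * cos (\<theta> n k) - b) /
      (a\<^sup>2 + b\<^sup>2 - 2 * a * b * cos (\<theta> n k)) powr (3 / 2))"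
proof -
  have "(\<Sum>z\<in>{z. z ^ n = - 1}. newton (of_real a * z - of_real b)) =
      of_real (\<Sum>z\<in>{z. z ^ n = - 1}. Re (newton (of_real a * z - of_real b)))"
    by (rule newton_sum_real) (simp flip: complex_cnj_power)
  also have "(\<Sum>z\<in>{z. z ^ n = - 1}. Re (newton (of_real a * z - of_real b))) =
      (\<Sum>k<n. Re (newton (of_real a * cis (\<theta> n (Suc k)) - of_real b)))"
    by (rule sum.reindex_bij_betw[OF bij_betw_roots_minus_one[OF assms], symmetric])
  also have "\<dots> = (\<Sum>k = 1..n. Re (newton (of_real a * cis (\<theta> n k) - of_real b)))"
    by (simp add: sum.atLeast1_atMost_eq)
  finally show ?thesis unfolding newton_cis .
qed

lemma sum_lessThan_add:
  fixes f :: "nat \<Rightarrow> 'a::comm_monoid_add"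
  shows "(\<Sum>j<n + k. f j) = (\<Sum>j<n. f j) + (\<Sum>j<k. f (n + j))"
  by (induction k) (simp_all add: add.assoc)

lemma crown_position_inner:
  "i < n \<Longrightarrow> crown_position n a i = cis (2 * pi * real i / real n)"
  by (simp add: crown_position_def)

lemma crown_position_outer:
  "crown_position n a (n + i) = of_real a * cis (\<theta> n (Suc i))"
  by (simp add: crown_position_def theta_Suc)

lemma inj_on_crown_position:
  assumes "n > 0" "a > 0"
  shows "inj_on (crown_position n a) {..<2 * n}"
proof (rule inj_onI)
  fix i j
  assume ij: "i \<in> {..<2 * n}" "j \<in> {..<2 * n}" "crown_position n a i = crown_position n a j"
  have disjoint: "crown_position n a i \<noteq> crown_position n a (n + j)" if "i < n" "j < n" for i j
  proof
    assume eq: "crown_position n a i = crown_position n a (n + j)"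
    \<comment> \<open>the \<open>n\<close>-th power is \<open>1\<close> on the inner and negative on the outer ring\<close>
    have "crown_position n a i ^ n = 1"
      using bij_betwE[OF Complex.bij_betw_roots_unity[OF assms(1)]] that
      by (simp add: crown_position_inner)
    moreover have "crown_position n a (n + j) ^ n = - of_real (a ^ n)"
      using bij_betwE[OF bij_betw_roots_minus_one[OF assms(1)]] that
      by (simp add: crown_position_outer power_mult_distrib)
    ultimately have "1 + of_real (a ^ n) = (0::complex)"
      unfolding eq by (metis add.left_inverse)
    then have "of_real (1 + a ^ n) = (0::complex)"
      by simp
    then have "1 + a ^ n = 0"
      by (simp only: of_real_eq_0_iff)
    moreover have "a ^ n > 0" using assms by simp
    ultimately show False by simp
  qed
  have inner: "inj_on (crown_position n a) {..<n}"
    using bij_betw_imp_inj_on[OF Complex.bij_betw_roots_unity[OF assms(1)]]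
    by (rule inj_on_cong[THEN iffD1, rotated]) (simp add: crown_position_inner)
  have outer: "i = j" if "i < n" "j < n" "crown_position n a (n + i) = crown_position n a (n + j)" for i j
    using that assms bij_betw_imp_inj_on[OF bij_betw_roots_minus_one[OF assms(1)]]
    by (auto simp: crown_position_outer dest: inj_onD)
  show "i = j"
  proof (cases "i < n"; cases "j < n")
    assume "i < n" "j < n"
    then show ?thesis using inner ij by (auto dest: inj_onD)
  next
    assume "i < n" "\<not> j < n"
    moreover have "j - n < n" "n + (j - n) = j" using \<open>\<not> j < n\<close> ij by auto
    ultimately show ?thesis using disjoint[of i "j - n"] \<open>i < n\<close> ij(3) by simp
  next
    assume "\<not> i < n" "j < n"
    moreover have "i - n < n" "n + (i - n) = i" using \<open>\<not> i < n\<close> ij by auto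
    ultimately show ?thesis using disjoint[of j "i - n"] \<open>j < n\<close> ij(3) by simp
  next
    assume "\<not> i < n" "\<not> j < n"
    moreover have "i - n < n" "n + (i - n) = i" "j - n < n" "n + (j - n) = j"
      using \<open>\<not> i < n\<close> \<open>\<not> j < n\<close> ij by auto
    ultimately show ?thesis using outer[of "i - n" "j - n"] ij(3) by metis
  qed
qed

lemma crown_force:
  assumes "n > 0"
  shows "(\<Sum>j<2 * n. crown_mass n m j *\<^sub>R newton (crown_position n a j - p)) =
    (\<Sum>z\<in>{z. z ^ n = 1}. newton (z - p)) + m *\<^sub>R (\<Sum>z\<in>{z. z ^ n = - 1}. newton (of_real a * z - p))"
proof -
  have "(\<Sum>j<n. crown_mass n m j *\<^sub>R newton (crown_position n a j - p)) =
      (\<Sum>j<n. newton (cis (2 * pi * real j / real n) - p))"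
    by (intro sum.cong) (auto simp: crown_mass_def crown_position_inner)
  also have "\<dots> = (\<Sum>z\<in>{z. z ^ n = 1}. newton (z - p))"
    by (rule sum.reindex_bij_betw[OF Complex.bij_betw_roots_unity[OF assms]])
  finally have 1: "(\<Sum>j<n. crown_mass n m j *\<^sub>R newton (crown_position n a j - p)) =
      (\<Sum>z\<in>{z. z ^ n = 1}. newton (z - p))" .
  have "(\<Sum>j<n. crown_mass n m (n + j) *\<^sub>R newton (crown_position n a (n + j) - p)) =
      m *\<^sub>R (\<Sum>j<n. newton (of_real a * cis (\<theta> n (Suc j)) - p))"
    by (simp add: crown_mass_def crown_position_outer scaleR_sum_right)
  also have "(\<Sum>j<n. newton (of_real a * cis (\<theta> n (Suc j)) - p)) =
      (\<Sum>z\<in>{z. z ^ n = - 1}. newton (of_real a * z - p))"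
    by (rule sum.reindex_bij_betw[OF bij_betw_roots_minus_one[OF assms]])
  finally show ?thesis
    using 1 by (simp add: mult_2 sum_lessThan_add)
qed

text \<open>Rescaling by \<open>a\<close> the picture in which the outer ring has radius \<open>1 / a\<close> exchanges the two rings.\<close>

lemma C21_inverse:
  assumes "a > 0"
  shows "C21 n (1 / a) = a\<^sup>2 * C12 n a"
proof -
  have "(1 / a - c) / (1 + (1 / a)\<^sup>2 - 2 * (1 / a) * c) powr (3 / 2) =
      a\<^sup>2 * ((1 - a * c) / (1 + a\<^sup>2 - 2 * a * c) powr (3 / 2))" if c: "- 1 \<le> c" "c \<le> 1" for c
  proof -
    have eq: "1 + (1 / a)\<^sup>2 - 2 * (1 / a) * c = (1 + a\<^sup>2 - 2 * a * c) / a\<^sup>2"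
      using assms by (simp add: field_simps power2_eq_square)
    have "a * c \<le> a" using assms c by simp
    then have "(1 - a)\<^sup>2 \<le> 1 + a\<^sup>2 - 2 * a * c"
      by (simp add: power2_eq_square algebra_simps)
    then have "0 \<le> 1 + a\<^sup>2 - 2 * a * c"
      using zero_le_power2 order_trans by blast
    then have pw: "(1 + (1 / a)\<^sup>2 - 2 * (1 / a) * c) powr (3 / 2) = (1 + a\<^sup>2 - 2 * a * c) powr (3 / 2) / a ^ 3"
      unfolding eq using assms by (simp add: powr_divide square_powr_three_halves)
    have "1 / a - c = (1 - a * c) / a"
      using assms by (simp add: field_simps)
    then show ?thesis
      unfolding pw using assms by (simp add: power2_eq_square power3_eq_cube)
  qed
  then show ?thesis
    unfolding C21_def C12_def sum_distrib_left by (intro sum.cong) auto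
qed

lemma F_inverse:
  assumes "a > 0"
  shows "F n (1 / a) = S n / a - a\<^sup>2 * C12 n a"
  using C21_inverse[OF assms] by (simp add: F_def)

text \<open>By the symmetry of the rings, the total force on a body is a real multiple of its position. Each
ring thus gives one equation for the multiplier \<open>l\<close>, and a solution exists if the two values of
\<open>l\<close> agree.\<close>

lemma twisted_crown_iff:
  assumes n: "n > 0" and a: "a > 0" and m: "m > 0"
  shows "twisted_crown n a m \<longleftrightarrow> m * F n (1 / a) = a * F n a"
proof -
  let ?q = "crown_position n a" and ?\<mu> = "crown_mass n m"
  let ?A = "\<lambda>i. \<Sum>j<2 * n. ?\<mu> j *\<^sub>R newton (?q j - ?q i)"
  have inner: "?A i + l *\<^sub>R ?q i = 0 \<longleftrightarrow> l = S n + m * C12 n a" if "i < n" for i l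
  proof -
    define v where "v = ?q i"
    have v: "v ^ n = 1"
      using bij_betwE[OF Complex.bij_betw_roots_unity[OF n]] that
      by (simp add: v_def crown_position_inner)
    have "v \<noteq> 0" using v n by (auto simp: power_0_left)
    have own: "(\<Sum>z\<in>{z. z ^ n = 1}. newton (z - v)) = v * of_real (- S n)"
      using newton_sum_own_ring[OF n v] newton_sum_roots_unity[OF n] by simp
    have other: "(\<Sum>z\<in>{z. z ^ n = - 1}. newton (of_real a * z - v)) = v * of_real (- C12 n a)"
      using newton_sum_other_ring[OF n, of v "- 1" a 1] v newton_sum_roots_minus_one[OF n, of a 1]
      by (simp add: C12_def add.commute minus_divide_left flip: sum_negf)
    have "?A i + l *\<^sub>R ?q i = v * of_real (l - (S n + m * C12 n a))"
      unfolding crown_force[OF n] v_def[symmetric] own other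
      by (simp add: scaleR_conv_of_real algebra_simps)
    also have "\<dots> = 0 \<longleftrightarrow> l = S n + m * C12 n a"
      using \<open>v \<noteq> 0\<close> by (simp only: mult_eq_0_iff of_real_eq_0_iff) simp
    finally show ?thesis .
  qed
  have outer: "?A i + l *\<^sub>R ?q i = 0 \<longleftrightarrow> l * a = C21 n a + m * S n / a\<^sup>2" if "n \<le> i" "i < 2 * n" for i l
  proof -
    define v where "v = cis (\<theta> n (Suc (i - n)))"
    have q: "?q i = of_real a * v"
      using crown_position_outer[of n a "i - n"] that by (simp add: v_def)
    have v: "v ^ n = - 1"
      using bij_betwE[OF bij_betw_roots_minus_one[OF n]] that by (simp add: v_def)
    have "v \<noteq> 0" by (simp add: v_def)
    have "(\<Sum>z\<in>{z. z ^ n = - 1}. newton (of_real a * z - of_real a * v)) =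
        (\<Sum>z\<in>{z. z ^ n = - 1}. newton (z - v) /\<^sub>R a\<^sup>2)"
      by (simp only: newton_dilate[OF a] flip: right_diff_distrib)
    also have "\<dots> = v * of_real (- S n / a\<^sup>2)"
      unfolding scaleR_sum_right[symmetric] newton_sum_own_ring[OF n v, simplified]
        newton_sum_roots_unity[OF n]
      by (simp add: scaleR_conv_of_real divide_inverse mult.commute)
    finally have own: "(\<Sum>z\<in>{z. z ^ n = - 1}. newton (of_real a * z - of_real a * v)) =
      v * of_real (- S n / a\<^sup>2)" .
    have other: "(\<Sum>z\<in>{z. z ^ n = 1}. newton (z - of_real a * v)) = v * of_real (- C21 n a)"
      using newton_sum_other_ring[OF n, of v 1 1 a] v newton_sum_roots_minus_one[OF n, of 1 a]
      by (simp add: C21_def minus_divide_left flip: sum_negf)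
    have "?A i + l *\<^sub>R ?q i = v * of_real (l * a - (C21 n a + m * S n / a\<^sup>2))"
      unfolding crown_force[OF n] q own other
      by (simp add: scaleR_conv_of_real algebra_simps)
    also have "\<dots> = 0 \<longleftrightarrow> l * a = C21 n a + m * S n / a\<^sup>2"
      using \<open>v \<noteq> 0\<close> by (simp only: mult_eq_0_iff of_real_eq_0_iff) simp
    finally show ?thesis .
  qed
  have "twisted_crown n a m \<longleftrightarrow> (\<exists>l. \<forall>i<2 * n. ?A i + l *\<^sub>R ?q i = 0)"
    unfolding twisted_crown_def using inj_on_crown_position[OF n a] m
    by (subst central_configuration_iff) (auto simp: crown_mass_def)
  also have "\<dots> \<longleftrightarrow> (\<exists>l. l = S n + m * C12 n a \<and> l * a = C21 n a + m * S n / a\<^sup>2)"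
  proof (intro iff_exI iffI allI impI conjI)
    fix l assume *: "\<forall>i<2 * n. ?A i + l *\<^sub>R ?q i = 0"
    show "l = S n + m * C12 n a" using * n inner[of 0 l] by simp
    show "l * a = C21 n a + m * S n / a\<^sup>2" using * n outer[of n l] by simp
  next
    fix l i assume *: "l = S n + m * C12 n a \<and> l * a = C21 n a + m * S n / a\<^sup>2" and "i < 2 * n"
    then show "?A i + l *\<^sub>R ?q i = 0"
      using inner[of i l] outer[of i l] by (cases "i < n") auto
  qed
  also have "\<dots> \<longleftrightarrow> (S n + m * C12 n a) * a = C21 n a + m * S n / a\<^sup>2"
    by simp
  also have "\<dots> \<longleftrightarrow> ((S n + m * C12 n a) * a) * a = (C21 n a + m * S n / a\<^sup>2) * a"
    using a by simp
  also have "\<dots> \<longleftrightarrow> m * F n (1 / a) = a * F n a"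
  proof -
    define p where "p = S n / a"
    have "(C21 n a + m * S n / a\<^sup>2) * a = C21 n a * a + m * p"
      using a by (simp add: p_def field_simps power2_eq_square)
    moreover have "F n (1 / a) = p - a\<^sup>2 * C12 n a"
      unfolding p_def by (rule F_inverse[OF a])
    moreover have "F n a = S n * a - C21 n a" by (rule F_def)
    moreover have "(S n + m * C12 n a) * a * a = C21 n a * a + m * p
        \<longleftrightarrow> m * (p - a\<^sup>2 * C12 n a) = a * (S n * a - C21 n a)"
      by (simp only: power2_eq_square distrib_left distrib_right left_diff_distrib right_diff_distrib ac_simps) argo
    ultimately show ?thesis by simp
  qed
  finally show ?thesis .
qed

section \<open>Comparison of the midpoint sum with S\<close>

text \<open>The points \<open>\<theta> n k / 2\<close> are the midpoints between consecutive multiples of \<open>pi / n\<close>. The two outermost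
ones, for \<open>k = 1\<close> and \<open>k = n\<close>, belong to the nearest bodies of the other ring, which are
estimated separately.\<close>

abbreviation midpoint_sum :: "nat \<Rightarrow> real" where
  "midpoint_sum n \<equiv> (\<Sum>k = 2..n - 1. 1 / sin (\<theta> n k / 2))"

text \<open>Convexity of \<open>1 / sin\<close>, improved by the factor \<open>cos h\<close>. It rests on
\<open>sin (x - h) * sin (x + h) = (sin x * cos h)\<^sup>2 - (cos x * sin h)\<^sup>2\<close>. The margin for \<open>n = 5\<close> is so
small that plain convexity would not suffice there.\<close>

lemma inverse_sin_pair:
  fixes x h :: real
  assumes "sin x > 0" "sin (x - h) > 0" "sin (x + h) > 0"
  shows "2 / sin x \<le> cos h * (1 / sin (x - h) + 1 / sin (x + h))"
proof -
  define P where "P = sin (x - h) * sin (x + h)"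
  have "P > 0" unfolding P_def using assms(2,3) by (rule mult_pos_pos)
  have "P = (sin x * cos h)\<^sup>2 - (cos x * sin h)\<^sup>2"
    unfolding P_def sin_diff sin_add power2_eq_square by (simp add: algebra_simps)
  then have P_le: "P \<le> (sin x * cos h)\<^sup>2" by simp
  have "1 / sin (x - h) + 1 / sin (x + h) = (sin (x - h) + sin (x + h)) / P"
    using assms by (simp add: P_def field_simps)
  also have "sin (x - h) + sin (x + h) = 2 * sin x * cos h"
    by (simp add: sin_diff sin_add)
  finally have "cos h * (1 / sin (x - h) + 1 / sin (x + h)) = 2 / sin x * ((sin x * cos h)\<^sup>2 / P)"
    using assms(1) by (simp add: power2_eq_square)
  moreover have "1 \<le> (sin x * cos h)\<^sup>2 / P"
    using P_le \<open>P > 0\<close> by simp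
  ultimately show ?thesis
    using assms(1) mult_left_mono[of 1 "(sin x * cos h)\<^sup>2 / P" "2 / sin x"] by simp
qed

lemma sin_between:
  assumes "0 \<le> \<alpha>" "\<alpha> \<le> x" "x \<le> pi - \<alpha>"
  shows "sin \<alpha> \<le> sin x"
proof (cases "x \<le> pi / 2")
  case True
  then show ?thesis using assms by (intro sin_monotone_2pi_le) auto
next
  case False
  have "sin \<alpha> \<le> sin (pi - x)"
    using False assms by (intro sin_monotone_2pi_le) auto
  then show ?thesis by simp
qed

lemma half_theta: "\<theta> n k / 2 = real k * pi / real n - pi / real n / 2"
  by (simp add: \<theta>_def add_divide_distrib diff_divide_distrib algebra_simps)

lemma half_theta_Suc: "\<theta> n (Suc k) / 2 = real k * pi / real n + pi / real n / 2"
  by (simp add: \<theta>_def add_divide_distrib diff_divide_distrib algebra_simps)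

lemma half_theta_bounds:
  assumes "1 \<le> k" "k \<le> n"
  shows "pi / real n / 2 \<le> \<theta> n k / 2" "\<theta> n k / 2 \<le> pi - pi / real n / 2"
  using assms by (auto simp: \<theta>_def field_simps)

lemma sin_half_step_le:
  assumes "1 \<le> k" "k \<le> n"
  shows "sin (pi / real n / 2) \<le> sin (\<theta> n k / 2)"
  using half_theta_bounds[OF assms] by (intro sin_between) auto

lemma sin_half_step_pos:
  assumes "n \<ge> 1"
  shows "sin (pi / real n / 2) > 0"
proof (rule sin_gt_zero)
  show "pi / real n / 2 > 0" using assms by simp
  show "pi / real n / 2 < pi" using assms by (simp add: field_simps)
qed

lemma cos_half_step_nonneg:
  assumes "n \<ge> 1"
  shows "cos (pi / real n / 2) \<ge> 0"
proof (rule cos_ge_zero)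
  have "pi / real n / 2 \<ge> 0" by simp
  moreover have "- (pi / 2) \<le> 0" by simp
  ultimately show "- (pi / 2) \<le> pi / real n / 2" by (rule order_trans[rotated])
  show "pi / real n / 2 \<le> pi / 2" using assms by (simp add: field_simps)
qed

lemma sin_half_theta_pos:
  assumes "1 \<le> k" "k \<le> n"
  shows "sin (\<theta> n k / 2) > 0"
  using sin_half_step_le[OF assms] sin_half_step_pos[of n] assms by linarith

lemma sin_multiple_pos:
  assumes "1 \<le> k" "k < n"
  shows "sin (real k * pi / real n) > 0"
  using assms by (intro sin_gt_zero) (auto simp: field_simps)

lemma half_theta_last: "n \<ge> 1 \<Longrightarrow> \<theta> n n / 2 = pi - pi / real n / 2"
  by (simp add: \<theta>_def field_simps)

lemma sum_ends:
  fixes f :: "nat \<Rightarrow> real"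
  assumes "n \<ge> 2"
  shows "(\<Sum>k = 1..n. f k) = f 1 + (\<Sum>k = 2..n - 1. f k) + f n"
proof -
  obtain m where n: "n = Suc (Suc m)" using assms by (metis add_2_eq_Suc le_Suc_ex)
  show ?thesis unfolding n
    by (simp add: sum.atLeast_Suc_atMost[of "Suc 0"] numeral_2_eq_2)
qed

lemma four_S: "4 * S n = (\<Sum>k = 1..n - 1. 1 / sin (real k * pi / real n))"
  by (simp add: S_def)

text \<open>Each multiple of \<open>pi / n\<close> is replaced by its two neighbouring midpoints; every midpoint is used
twice, except the outermost ones, which are used once and have the same sine.\<close>

lemma S_le_midpoints:
  assumes n: "n \<ge> 2"
  shows "4 * S n \<le> midpoint_sum n + 1 / sin (pi / real n / 2)"
proof -
  let ?f = "\<lambda>k. 1 / sin (\<theta> n k / 2)"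
  obtain m where m: "n = Suc (Suc m)" using n by (metis add_2_eq_Suc le_Suc_ex)
  have "2 * (1 / sin (real k * pi / real n)) \<le> ?f k + ?f (Suc k)" if k: "k \<in> {1..n - 1}" for k
  proof -
    have pos: "sin (\<theta> n k / 2) > 0" "sin (\<theta> n (Suc k) / 2) > 0" "sin (real k * pi / real n) > 0"
      using k n by (auto intro!: sin_half_theta_pos sin_multiple_pos)
    then have "2 / sin (real k * pi / real n) \<le> cos (pi / real n / 2) * (?f k + ?f (Suc k))"
      using inverse_sin_pair[of "real k * pi / real n" "pi / real n / 2"]
      unfolding half_theta[of n k, symmetric] half_theta_Suc[of n k, symmetric] by simp
    also have "\<dots> \<le> ?f k + ?f (Suc k)"
      using pos cos_half_step_nonneg[of n] n by (intro mult_left_le_one_le add_nonneg_nonneg) auto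
    finally show ?thesis by simp
  qed
  then have "(\<Sum>k = 1..n - 1. 2 * (1 / sin (real k * pi / real n))) \<le> (\<Sum>k = 1..n - 1. ?f k + ?f (Suc k))"
    by (rule sum_mono)
  then have "2 * (4 * S n) \<le> (\<Sum>k = 1..n - 1. ?f k) + (\<Sum>k = 1..n - 1. ?f (Suc k))"
    unfolding four_S sum.distrib sum_distrib_left[symmetric] .
  also have "(\<Sum>k = 1..n - 1. ?f k) = ?f 1 + midpoint_sum n"
    unfolding m by (simp add: sum.atLeast_Suc_atMost[of "Suc 0"] numeral_2_eq_2)
  also have "(\<Sum>k = 1..n - 1. ?f (Suc k)) = (\<Sum>k = Suc 1..Suc (n - 1). ?f k)"
    by (rule sum.shift_bounds_cl_Suc_ivl[symmetric])
  also have "\<dots> = midpoint_sum n + ?f n"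
    unfolding m by (simp add: numeral_2_eq_2)
  also have "?f n = 1 / sin (pi / real n / 2)"
    using n by (simp only: half_theta_last[of n] sin_pi_minus)
  also have "?f 1 = 1 / sin (pi / real n / 2)"
    by (simp add: \<theta>_def)
  finally show ?thesis by simp
qed

text \<open>The converse comparison: each inner midpoint is replaced by its two neighbouring multiples of
\<open>pi / n\<close>. The first and the last multiple are used only once, which gains \<open>1 / sin (pi / n)\<close>. That gain
is what makes \<open>F n\<close> positive at a point close to \<open>1\<close>.\<close>

lemma midpoints_le_S:
  assumes n: "n \<ge> 2"
  shows "midpoint_sum n \<le> cos (pi / real n / 2) * (4 * S n - 1 / sin (pi / real n))"
proof -
  let ?g = "\<lambda>k. 1 / sin (real k * pi / real n)"
  let ?c = "cos (pi / real n / 2)"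
  obtain m where m: "n = Suc (Suc m)" using n by (metis add_2_eq_Suc le_Suc_ex)
  have "2 * (1 / sin (\<theta> n (Suc k) / 2)) \<le> ?c * (?g k + ?g (Suc k))" if k: "k \<in> {1..m}" for k
  proof -
    have lower: "\<theta> n (Suc k) / 2 - pi / real n / 2 = real k * pi / real n"
      by (simp add: half_theta_Suc)
    have upper: "\<theta> n (Suc k) / 2 + pi / real n / 2 = real (Suc k) * pi / real n"
      by (simp add: half_theta)
    have "sin (\<theta> n (Suc k) / 2) > 0" "sin (real k * pi / real n) > 0" "sin (real (Suc k) * pi / real n) > 0"
      using k m by (auto intro!: sin_half_theta_pos sin_multiple_pos simp del: of_nat_Suc)
    then show ?thesis
      using inverse_sin_pair[of "\<theta> n (Suc k) / 2" "pi / real n / 2"]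
      unfolding lower upper by simp
  qed
  then have "(\<Sum>k = 1..m. 2 * (1 / sin (\<theta> n (Suc k) / 2))) \<le> (\<Sum>k = 1..m. ?c * (?g k + ?g (Suc k)))"
    by (rule sum_mono)
  then have "2 * (\<Sum>k = 1..m. 1 / sin (\<theta> n (Suc k) / 2))
      \<le> ?c * ((\<Sum>k = 1..m. ?g k) + (\<Sum>k = 1..m. ?g (Suc k)))"
    by (simp only: sum.distrib flip: sum_distrib_left)
  also have "(\<Sum>k = 1..m. 1 / sin (\<theta> n (Suc k) / 2)) = (\<Sum>k = Suc 1..Suc m. 1 / sin (\<theta> n k / 2))"
    by (rule sum.shift_bounds_cl_Suc_ivl[symmetric])
  also have "\<dots> = midpoint_sum n"
    unfolding m by (simp add: numeral_2_eq_2)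
  also have "(\<Sum>k = 1..m. ?g k) = 4 * S n - ?g (Suc m)"
    unfolding four_S m by simp
  also have "(\<Sum>k = 1..m. ?g (Suc k)) = (\<Sum>k = Suc 1..Suc m. ?g k)"
    by (rule sum.shift_bounds_cl_Suc_ivl[symmetric])
  also have "\<dots> = 4 * S n - ?g 1"
    unfolding four_S m using sum.atLeast_Suc_atMost[of 1 "Suc m" ?g] by (simp add: m)
  also have "?g (Suc m) = 1 / sin (pi / real n)"
  proof -
    have "real (Suc m) * pi / real n = pi - pi / real n" unfolding m by (simp add: field_simps)
    then show ?thesis by (simp only: sin_pi_minus)
  qed
  finally show ?thesis by (simp add: algebra_simps)
qed

text \<open>Both sides agree for \<open>s = 1\<close>, where the attracting body is diametrically opposite. In general
the numerator is at most \<open>s\<^sup>2 * (1 + b)\<close> and the squared distance at least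
\<open>s\<^sup>2 * (1 + b)\<^sup>2\<close>.\<close>

lemma attraction_le:
  fixes b s :: real
  assumes "0 < b" "b \<le> 1" "0 < s" "s \<le> 1"
  shows "(b - (1 - 2 * s\<^sup>2)) / (1 + b\<^sup>2 - 2 * b * (1 - 2 * s\<^sup>2)) powr (3 / 2) \<le> 1 / ((1 + b)\<^sup>2 * s)"
proof -
  define D where "D = 1 + b\<^sup>2 - 2 * b * (1 - 2 * s\<^sup>2)"
  have "s\<^sup>2 \<le> 1" using assms by (simp add: power_le_one)
  have "D - (s * (1 + b))\<^sup>2 = (1 - b)\<^sup>2 * (1 - s\<^sup>2)"
    unfolding D_def power2_eq_square by algebra
  also have "\<dots> \<ge> 0" using \<open>s\<^sup>2 \<le> 1\<close> by simp
  finally have "(s * (1 + b))\<^sup>2 powr (3 / 2) \<le> D powr (3 / 2)"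
    by (intro powr_mono2) auto
  then have D: "(s * (1 + b)) ^ 3 \<le> D powr (3 / 2)"
    using assms by (subst (asm) square_powr_three_halves) auto
  have "s\<^sup>2 * (1 + b) - (b - (1 - 2 * s\<^sup>2)) = (1 - b) * (1 - s\<^sup>2)"
    by (simp add: algebra_simps)
  also have "\<dots> \<ge> 0" using assms \<open>s\<^sup>2 \<le> 1\<close> by simp
  finally have "(b - (1 - 2 * s\<^sup>2)) / D powr (3 / 2) \<le> s\<^sup>2 * (1 + b) / D powr (3 / 2)"
    by (intro divide_right_mono) auto
  also have "\<dots> \<le> s\<^sup>2 * (1 + b) / (s * (1 + b)) ^ 3"
  proof (rule divide_left_mono[OF D])
    have "0 < (s * (1 + b)) ^ 3" using assms by simp
    with D show "0 < D powr (3 / 2) * (s * (1 + b)) ^ 3"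
      by (intro mult_pos_pos) linarith+
  qed (use assms in simp)
  also have "\<dots> = 1 / ((1 + b)\<^sup>2 * s)"
    using assms by (simp add: divide_simps power2_eq_square power3_eq_cube)
  finally show ?thesis unfolding D_def .
qed

text \<open>Let \<open>D\<close> be the squared distance in the denominator. The numerator is at least \<open>D / 2\<close>, since
\<open>b\<^sup>2 \<le> 1\<close>, and \<open>D \<le> 4 * s\<^sup>2\<close> by the last hypothesis; both are equalities for \<open>b = 1\<close>.\<close>

lemma attraction_ge:
  fixes b s :: real
  assumes "0 < b" "b \<le> 1" "0 < s" "1 - b \<le> 4 * s\<^sup>2"
  shows "1 / (4 * s) \<le> (1 - b * (1 - 2 * s\<^sup>2)) / (1 + b\<^sup>2 - 2 * b * (1 - 2 * s\<^sup>2)) powr (3 / 2)"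
proof -
  define D where "D = 1 + b\<^sup>2 - 2 * b * (1 - 2 * s\<^sup>2)"
  define y where "y = sqrt D"
  have D_eq: "D = (1 - b)\<^sup>2 + 4 * b * s\<^sup>2"
    by (simp add: D_def power2_eq_square algebra_simps)
  have "0 < 4 * b * s\<^sup>2" using assms by simp
  then have "D > 0" unfolding D_eq using zero_le_power2[of "1 - b"] by linarith
  then have y: "y > 0" "y\<^sup>2 = D" by (simp_all add: y_def)
  have "4 * s\<^sup>2 - D = (1 - b) * (4 * s\<^sup>2 - (1 - b))"
    by (simp add: D_eq power2_eq_square algebra_simps)
  also have "\<dots> \<ge> 0" using assms by simp
  finally have "y\<^sup>2 \<le> (2 * s)\<^sup>2" using y by (simp add: power_mult_distrib)
  then have "y \<le> 2 * s" by (rule power2_le_imp_le) (use assms in simp)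
  have "b\<^sup>2 \<le> 1" using assms by (simp add: power_le_one)
  then have D_le: "D \<le> 2 * (1 - b * (1 - 2 * s\<^sup>2))"
    by (simp add: D_def algebra_simps)
  have "1 / (4 * s) \<le> 1 / (2 * y)"
    using \<open>y \<le> 2 * s\<close> y assms by (simp add: field_simps)
  also have "\<dots> = (y\<^sup>2 / 2) / y ^ 3"
    using y(1) by (simp add: power2_eq_square power3_eq_cube)
  also have "y ^ 3 = D powr (3 / 2)"
    using square_powr_three_halves[of y] y by simp
  also have "(y\<^sup>2 / 2) / D powr (3 / 2) \<le> (1 - b * (1 - 2 * s\<^sup>2)) / D powr (3 / 2)"
    unfolding y(2) using D_le by (intro divide_right_mono) auto
  finally show ?thesis unfolding D_def .
qed

lemma cos_theta: "cos (\<theta> n k) = 1 - 2 * (sin (\<theta> n k / 2))\<^sup>2"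
  using cos_double_sin[of "\<theta> n k / 2"] by simp

lemma cos_theta_ends:
  assumes "n \<ge> 1"
  shows "cos (\<theta> n 1) = cos (pi / real n)" "cos (\<theta> n n) = cos (pi / real n)"
proof -
  show "cos (\<theta> n 1) = cos (pi / real n)" by (simp add: \<theta>_def)
  have "\<theta> n n = 2 * pi - pi / real n" using assms by (simp add: \<theta>_def field_simps)
  then show "cos (\<theta> n n) = cos (pi / real n)" by (simp add: cos_2pi_minus)
qed

text \<open>The terms of the two nearest bodies are kept unchanged: they are the ones that can be zero or
negative, and they decide the sign of \<open>F n b\<close>.\<close>

lemma C21_le:
  assumes n: "n \<ge> 2" and b: "0 < b" "b \<le> 1"
  shows "C21 n b \<le>
    2 * (b - cos (pi / real n)) / (1 + b\<^sup>2 - 2 * b * cos (pi / real n)) powr (3 / 2)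
    + midpoint_sum n / (1 + b)\<^sup>2"
proof -
  let ?f = "\<lambda>k. (b - cos (\<theta> n k)) / (1 + b\<^sup>2 - 2 * b * cos (\<theta> n k)) powr (3 / 2)"
  have "?f k \<le> 1 / sin (\<theta> n k / 2) / (1 + b)\<^sup>2" if "k \<in> {2..n - 1}" for k
  proof -
    have "1 \<le> k" "k \<le> n" using that n by auto
    then show ?thesis
      using attraction_le[OF b sin_half_theta_pos sin_le_one, of k n]
      unfolding cos_theta by (simp add: mult.commute)
  qed
  then have "(\<Sum>k = 2..n - 1. ?f k) \<le> midpoint_sum n / (1 + b)\<^sup>2"
    unfolding sum_divide_distrib by (rule sum_mono)
  moreover have "C21 n b = ?f 1 + (\<Sum>k = 2..n - 1. ?f k) + ?f n"
    unfolding C21_def by (rule sum_ends[OF n])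
  ultimately show ?thesis
    using cos_theta_ends[of n] n by simp
qed

lemma C12_ge:
  assumes n: "n \<ge> 2" and b: "0 < b" "b \<le> 1" and b': "1 - b \<le> 4 * (sin (pi / real n / 2))\<^sup>2"
  shows "2 * (1 - b * cos (pi / real n)) / (1 + b\<^sup>2 - 2 * b * cos (pi / real n)) powr (3 / 2)
    + midpoint_sum n / 4 \<le> C12 n b"
proof -
  let ?f = "\<lambda>k. (1 - b * cos (\<theta> n k)) / (1 + b\<^sup>2 - 2 * b * cos (\<theta> n k)) powr (3 / 2)"
  have "1 / sin (\<theta> n k / 2) / 4 \<le> ?f k" if "k \<in> {2..n - 1}" for k
  proof -
    have k: "1 \<le> k" "k \<le> n" using that n by auto
    have "0 \<le> sin (pi / real n / 2)" using sin_half_step_pos[of n] n by simp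
    with sin_half_step_le[OF k] have "(sin (pi / real n / 2))\<^sup>2 \<le> (sin (\<theta> n k / 2))\<^sup>2"
      by (rule power_mono)
    then show ?thesis
      using attraction_ge[OF b sin_half_theta_pos[OF k]] b'
      unfolding cos_theta by (simp add: mult.commute)
  qed
  then have "midpoint_sum n / 4 \<le> (\<Sum>k = 2..n - 1. ?f k)"
    unfolding sum_divide_distrib by (rule sum_mono)
  moreover have "C12 n b = ?f 1 + (\<Sum>k = 2..n - 1. ?f k) + ?f n"
    unfolding C12_def by (rule sum_ends[OF n])
  ultimately show ?thesis
    using cos_theta_ends[of n] n by simp
qed

text \<open>At radius \<open>1\<close> the force of the other ring is a quarter of the sum of \<open>1 / sin\<close> over all the
midpoints, which exceeds that over the multiples of \<open>pi / n\<close>.\<close>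

lemma F_one_neg:
  assumes n: "n \<ge> 2"
  shows "F n 1 < 0"
proof -
  let ?s = "sin (pi / real n / 2)"
  have s: "?s > 0" using sin_half_step_pos[of n] n by simp
  have "4 * S n \<le> midpoint_sum n + 1 / ?s" by (rule S_le_midpoints[OF n])
  moreover have "2 * (1 - cos (pi / real n)) / (2 - 2 * cos (pi / real n)) powr (3 / 2) + midpoint_sum n / 4
      \<le> C12 n 1"
    using C12_ge[OF n, of 1] by simp
  moreover have "2 * (1 - cos (pi / real n)) / (2 - 2 * cos (pi / real n)) powr (3 / 2) = 1 / (2 * ?s)"
  proof -
    have c: "cos (pi / real n) = 1 - 2 * ?s\<^sup>2"
      using cos_double_sin[of "pi / real n / 2"] by simp
    have "2 - 2 * cos (pi / real n) = (2 * ?s)\<^sup>2"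
      by (simp add: c power_mult_distrib)
    then have "(2 - 2 * cos (pi / real n)) powr (3 / 2) = (2 * ?s) ^ 3"
      using square_powr_three_halves[of "2 * ?s"] s by simp
    then show ?thesis
      using s by (simp add: c power2_eq_square power3_eq_cube)
  qed
  moreover have "1 / (2 * ?s) > 0" "1 / ?s = 2 * (1 / (2 * ?s))" using s by auto
  ultimately have "S n < C12 n 1" by linarith
  then show ?thesis using F_inverse[of 1 n] by simp
qed

text \<open>In the sum \<open>4 * S n\<close> the first and the last term are \<open>1 / sin (pi / n)\<close>, and the others are at most
\<open>1 / sin (2 * pi / n)\<close>.\<close>

lemma S_sin_le:
  assumes n: "n \<ge> 4"
  shows "4 * S n * sin (pi / real n) \<le> 2 + (real n - 3) / (2 * cos (pi / real n))"
proof -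
  let ?g = "\<lambda>k. sin (pi / real n) / sin (real k * pi / real n)"
  define m where "m = n - 2"
  have m: "n = Suc (Suc m)" using n by (simp add: m_def)
  have s: "sin (pi / real n) > 0" using sin_multiple_pos[of 1 n] n by simp
  have c: "cos (pi / real n) > 0"
    using n by (intro cos_gt_zero) (auto simp: field_simps)
  have "?g k \<le> 1 / (2 * cos (pi / real n))" if k: "k \<in> {2..m}" for k
  proof -
    have "sin (2 * (pi / real n)) \<le> sin (real k * pi / real n)"
    proof -
      define p where "p = pi / real n"
      have "p \<ge> 0" by (simp add: p_def)
      have "2 * p \<le> real k * p" using k \<open>p \<ge> 0\<close> by (intro mult_right_mono) auto
      moreover have "(real k + 2) * p \<le> real n * p"
        using k \<open>p \<ge> 0\<close> m by (intro mult_right_mono) auto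
      moreover have "real n * p = pi" using n by (simp add: p_def)
      ultimately have "sin (2 * p) \<le> sin (real k * p)"
        using \<open>p \<ge> 0\<close> by (intro sin_between) (auto simp: algebra_simps)
      then show ?thesis by (simp add: p_def)
    qed
    then have "2 * sin (pi / real n) * cos (pi / real n) \<le> sin (real k * pi / real n)"
      by (simp only: sin_double)
    moreover have pos: "0 < 2 * sin (pi / real n) * cos (pi / real n)" using s c by simp
    ultimately have "?g k \<le> sin (pi / real n) / (2 * sin (pi / real n) * cos (pi / real n))"
      using s by (intro divide_left_mono mult_pos_pos less_le_trans[OF pos]) auto
    then show ?thesis using s by simp
  qed
  then have "(\<Sum>k = 2..m. ?g k) \<le> (\<Sum>k = 2..m. 1 / (2 * cos (pi / real n)))"
    by (rule sum_mono)
  also have "\<dots> = (real n - 3) / (2 * cos (pi / real n))"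
    using n by (simp add: m)
  finally have "(\<Sum>k = 2..m. ?g k) \<le> (real n - 3) / (2 * cos (pi / real n))" .
  moreover have "4 * S n * sin (pi / real n) = (\<Sum>k = 1..n - 1. ?g k)"
    by (simp add: S_def sum_distrib_left mult.commute)
  moreover have "(\<Sum>k = 1..n - 1. ?g k) = ?g 1 + (\<Sum>k = 2..m. ?g k) + ?g (n - 1)"
    using sum_ends[of "n - 1" ?g] n by (simp add: m_def numeral_2_eq_2)
  moreover have "?g (n - 1) = 1"
  proof -
    have "real (n - 1) * pi / real n = pi - pi / real n" using n by (simp add: field_simps)
    then show ?thesis using s by (simp only: sin_pi_minus) simp
  qed
  moreover have "?g 1 = 1" using s by simp
  ultimately show ?thesis by linarith
qed

section \<open>Sign changes of F\<close>

text \<open>Every term of the sum \<open>4 * S n\<close> is at least \<open>1\<close>.\<close>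

lemma S_ge:
  assumes "n \<ge> 1"
  shows "(real n - 1) / 4 \<le> S n"
proof -
  have "1 \<le> 1 / sin (real k * pi / real n)" if "k \<in> {1..n - 1}" for k
    using sin_multiple_pos[of k n] that by auto
  then have "(\<Sum>k = 1..n - 1. 1) \<le> (\<Sum>k = 1..n - 1. 1 / sin (real k * pi / real n))"
    by (rule sum_mono)
  then show ?thesis unfolding S_def using assms by simp
qed

text \<open>For \<open>x = pi / 5\<close> the angles \<open>3 * x\<close> and \<open>2 * x\<close> add up to \<open>pi\<close>, which gives a cubic equation for
\<open>cos x\<close>; it has the root \<open>-1\<close>.\<close>

lemma cos_pi_fifth:
  defines "b \<equiv> cos (pi / 5)"
  shows "4 * b\<^sup>2 = 2 * b + 1" "b > 0"
proof -
  show "b > 0" unfolding b_def by (intro cos_gt_zero) auto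
  have "cos (3 * (pi / 5)) = cos (pi - 2 * (pi / 5))"
    by (rule arg_cong[of _ _ cos]) simp
  also have "\<dots> = - cos (2 * (pi / 5))" by (rule cos_pi_minus)
  finally have "4 * b ^ 3 - 3 * b = - (2 * b\<^sup>2 - 1)"
    unfolding b_def cos_double_cos cos_treble_cos .
  then have "(b + 1) * (4 * b\<^sup>2 - 2 * b - 1) = 0"
    by (simp add: power2_eq_square power3_eq_cube algebra_simps)
  with \<open>b > 0\<close> show "4 * b\<^sup>2 = 2 * b + 1" by simp
qed

lemma one_minus_cos_le: "1 - cos x \<le> x\<^sup>2 / 2" for x :: real
proof -
  have "1 - cos x = 2 * (sin (x / 2))\<^sup>2"
    using cos_double_sin[of "x / 2"] by simp
  moreover have "(sin (x / 2))\<^sup>2 \<le> (x / 2)\<^sup>2"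
    using abs_sin_x_le_abs_x[of "x / 2"] by (simp only: abs_le_square_iff)
  ultimately show ?thesis by (simp add: power_divide)
qed

text \<open>The numerical core of the case \<open>n \<ge> 5\<close>. For large \<open>n\<close> the left side is of order \<open>1 / n\<close>, because
\<open>1 - b\<close> is of order \<open>1 / n\<^sup>2\<close>. For \<open>n = 5\<close> it equals \<open>2 * b - 5 / 8\<close>, about \<open>0.993\<close>, which calls
for the exact value of \<open>cos (pi / 5)\<close>.\<close>

lemma cos_step_estimate:
  assumes n: "n \<ge> 5"
  defines "b \<equiv> cos (pi / real n)"
  shows "(2 + (real n - 3) / (2 * b)) * ((1 - b) * (4 + 3 * b) / 4) < 1" "b \<ge> 4 / 5"
proof -
  have "(2 + (real n - 3) / (2 * b)) * ((1 - b) * (4 + 3 * b) / 4) < 1 \<and> b \<ge> 4 / 5"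
  proof (cases "n = 5")
    case True
    have b: "4 * b\<^sup>2 = 2 * b + 1" "b > 0"
      using cos_pi_fifth unfolding b_def True by simp_all
    have recip: "b * (4 * b - 2) = 1" using b by (simp add: power2_eq_square algebra_simps)
    have lower: "b \<ge> 4 / 5"
    proof (rule ccontr)
      assume "\<not> b \<ge> 4 / 5"
      then have "b * (4 * b - 2) \<le> b * (6 / 5)"
        using b(2) by (intro mult_left_mono) auto
      then show False using recip \<open>\<not> b \<ge> 4 / 5\<close> by simp
    qed
    have upper: "b < 13 / 16"
    proof (rule ccontr)
      assume "\<not> b < 13 / 16"
      then have "(13 / 16) * (5 / 4) \<le> b * (4 * b - 2)"
        by (intro mult_mono) auto
      then show False using recip by simp
    qed
    have "2 + (real n - 3) / (2 * b) = 4 * b"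
    proof -
      have "1 / b = 4 * b - 2" using b by (simp add: field_simps power2_eq_square)
      then show ?thesis by (simp add: True)
    qed
    moreover have "(4 * b) * ((1 - b) * (4 + 3 * b) / 4) < 1"
    proof -
      have "(1 - b) * (4 + 3 * b) = 13 / 4 - 5 / 2 * b"
        using b(1) by (simp add: algebra_simps power2_eq_square)
      then have "(4 * b) * ((1 - b) * (4 + 3 * b) / 4) = b * (13 / 4 - 5 / 2 * b)" by simp
      also have "\<dots> = 13 / 4 * b - 5 / 8 * (4 * b\<^sup>2)"
        by (simp add: algebra_simps power2_eq_square)
      also have "\<dots> = 2 * b - 5 / 8" unfolding b(1) by (simp add: field_simps)
      also have "\<dots> < 1" using upper by simp
      finally show ?thesis .
    qed
    ultimately show ?thesis using lower by simp
  next
    case False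
    with n have n6: "n \<ge> 6" by simp
    have "cos (pi / 6) \<le> b"
      unfolding b_def using n6 by (intro cos_monotone_0_pi_le) (auto simp: field_simps)
    moreover have "0.866 < sqrt 3 / 2"
    proof -
      have "1.732 < sqrt 3" by (rule real_less_rsqrt) (simp add: power2_eq_square)
      then show ?thesis by simp
    qed
    ultimately have b: "b > 0.866" by (simp add: cos_30)
    have "b \<le> 1" by (simp add: b_def)
    have "(real n - 3) / (2 * b) \<le> (real n - 3) / (2 * 0.866)"
      using b n6 by (intro divide_left_mono) auto
    also have "\<dots> \<le> 0.578 * (real n - 3)" using n6 by simp
    finally have 1: "2 + (real n - 3) / (2 * b) \<le> 2 + 0.578 * (real n - 3)" by simp
    have "1 - b \<le> (pi / real n)\<^sup>2 / 2" unfolding b_def by (rule one_minus_cos_le)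
    also have "\<dots> = pi\<^sup>2 / (2 * (real n)\<^sup>2)" by (simp add: power_divide)
    also have "pi\<^sup>2 \<le> 3.15\<^sup>2" using pi_approx by (intro power_mono) auto
    finally have 2: "1 - b \<le> 3.15\<^sup>2 / (2 * (real n)\<^sup>2)" by (simp add: divide_right_mono)
    have "(1 - b) * (4 + 3 * b) / 4 \<le> 3.15\<^sup>2 / (2 * (real n)\<^sup>2) * 7 / 4"
      using 2 \<open>b \<le> 1\<close> b by (intro divide_right_mono mult_mono) auto
    then have "(2 + (real n - 3) / (2 * b)) * ((1 - b) * (4 + 3 * b) / 4)
        \<le> (2 + 0.578 * (real n - 3)) * (3.15\<^sup>2 / (2 * (real n)\<^sup>2) * 7 / 4)"
      using 1 n6 b \<open>b \<le> 1\<close> by (intro mult_mono) auto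
    also have "\<dots> = (2 + 0.578 * (real n - 3)) * (3.15\<^sup>2 * 7 / 8) / (real n)\<^sup>2"
      by simp
    also have "\<dots> < 1"
    proof -
      have "(2 + 0.578 * (real n - 3)) * (3.15\<^sup>2 * 7 / 8) < 6 * real n"
      proof -
        have "real n \<ge> 6" using n6 by simp
        then show ?thesis by (simp add: power2_eq_square field_simps)
      qed
      also have "\<dots> \<le> (real n)\<^sup>2" using n6 by (simp add: power2_eq_square)
      finally show ?thesis using n6 by simp
    qed
    finally show ?thesis using b by simp
  qed
  then show "(2 + (real n - 3) / (2 * b)) * ((1 - b) * (4 + 3 * b) / 4) < 1" "b \<ge> 4 / 5"
    by simp_all
qed

text \<open>For \<open>b = cos (pi / n)\<close> the terms of the nearest bodies vanish in \<open>C21 n b\<close> and amount to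
\<open>2 / sin (pi / n)\<close> in \<open>C12 n b\<close>. With \<open>Q = 4 * S n * sin (pi / n)\<close> and \<open>t = cos (pi / (2 * n))\<close>, both claims
follow from the inequality \<open>Q * (1 - b * t ^ 3) < 1\<close>.\<close>

lemma F_changes_sign_at_cos:
  assumes n: "n \<ge> 5"
  defines "b \<equiv> cos (pi / real n)"
  shows "F n b > 0" "F n (1 / b) < 0"
proof -
  define d where "d = sin (pi / real n)"
  define t where "t = cos (pi / real n / 2)"
  define s where "s = sin (pi / real n / 2)"
  define Q where "Q = 4 * S n * d"
  have n2: "n \<ge> 2" "n \<ge> 4" using n by auto
  have d: "d > 0" using sin_multiple_pos[of 1 n] n by (simp add: d_def)
  have s: "s > 0" using sin_half_step_pos[of n] n by (simp add: s_def)
  have b: "b \<ge> 4 / 5" using cos_step_estimate(2)[OF n] by (simp add: b_def)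
  have "d\<^sup>2 + b\<^sup>2 = 1" by (simp add: d_def b_def)
  then have "b\<^sup>2 < 1\<^sup>2" using d by (smt (verit) one_power2 zero_less_power)
  then have "b < 1" by (rule power2_less_imp_less) simp
  have "t \<ge> 0" using cos_half_step_nonneg[of n] n by (simp add: t_def)
  have bt: "b = 2 * t\<^sup>2 - 1" using cos_double_cos[of "pi / real n / 2"] by (simp add: b_def t_def)
  have bs: "b = 1 - 2 * s\<^sup>2" using cos_double_sin[of "pi / real n / 2"] by (simp add: b_def s_def)
  have dst: "d = 2 * s * t" using sin_double[of "pi / real n / 2"] by (simp add: d_def s_def t_def)
  have "t > 0" using \<open>t \<ge> 0\<close> dst d by (cases "t = 0") auto
  have "t \<le> 1" by (simp add: t_def)
  have "1 + b\<^sup>2 - 2 * b * b = d\<^sup>2" using \<open>d\<^sup>2 + b\<^sup>2 = 1\<close> by (simp add: power2_eq_square)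
  then have D: "(1 + b\<^sup>2 - 2 * b * b) powr (3 / 2) = d ^ 3"
    using square_powr_three_halves[of d] d by simp
  have "Q \<le> 2 + (real n - 3) / (2 * b)"
    using S_sin_le[of n] n by (simp add: Q_def d_def b_def)
  \<comment> \<open>\<open>t ^ 3\<close>, as a convex function of \<open>t\<^sup>2 = (1 + b) / 2\<close>, lies above its tangent at \<open>1\<close>\<close>
  have "2 * t ^ 3 - 3 * t\<^sup>2 + 1 = (t - 1)\<^sup>2 * (2 * t + 1)"
    by (simp add: power2_eq_square power3_eq_cube algebra_simps)
  also have "\<dots> \<ge> 0" using \<open>t > 0\<close> by simp
  finally have "b * ((1 + 3 * b) / 4) \<le> b * t ^ 3"
    using b bt by (intro mult_left_mono) auto
  then have "1 - b * t ^ 3 \<le> (1 - b) * (4 + 3 * b) / 4"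
    by (simp add: algebra_simps)
  then have "Q * (1 - b * t ^ 3) \<le> (2 + (real n - 3) / (2 * b)) * ((1 - b) * (4 + 3 * b) / 4)"
    using \<open>Q \<le> _\<close> b \<open>b < 1\<close> \<open>t > 0\<close> \<open>t \<le> 1\<close> n
    by (intro mult_mono) (auto intro!: mult_le_one power_le_one)
  also have "\<dots> < 1" using cos_step_estimate(1)[OF n] by (simp add: b_def)
  finally have key: "Q * (1 - b * t ^ 3) < 1" .
  show "F n b > 0"
  proof -
    have "C21 n b \<le> midpoint_sum n / (1 + b)\<^sup>2"
      using C21_le[OF n2(1), of b] b \<open>b < 1\<close> by (simp add: b_def)
    also have "\<dots> \<le> t * (4 * S n - 1 / d) / (1 + b)\<^sup>2"
      using midpoints_le_S[OF n2(1)] unfolding t_def d_def by (intro divide_right_mono) auto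
    also have "\<dots> = (Q - 1) / (4 * t ^ 3 * d)"
      using \<open>t > 0\<close> d unfolding Q_def bt by (simp add: field_simps power2_eq_square power3_eq_cube)
    also have "\<dots> < Q * b * t ^ 3 / (4 * t ^ 3 * d)"
      using key \<open>t > 0\<close> d by (intro divide_strict_right_mono) (auto simp: algebra_simps)
    also have "\<dots> = S n * b"
      using \<open>t > 0\<close> d by (simp add: Q_def)
    finally show ?thesis by (simp add: F_def)
  qed
  show "F n (1 / b) < 0"
  proof -
    have "S n > 0" using S_ge[of n] n by simp
    have "2 * (1 - b * b) / d ^ 3 + midpoint_sum n / 4 \<le> C12 n b"
      using C12_ge[OF n2(1), of b] b \<open>b < 1\<close> bs D by (simp add: b_def s_def)
    moreover have "2 * (1 - b * b) / d ^ 3 = 2 / d"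
    proof -
      have "1 - b * b = d\<^sup>2" using \<open>d\<^sup>2 + b\<^sup>2 = 1\<close> by (simp add: power2_eq_square)
      then show ?thesis using d by (simp add: power2_eq_square power3_eq_cube)
    qed
    moreover have "4 * S n \<le> midpoint_sum n + 1 / s"
      using S_le_midpoints[OF n2(1)] by (simp add: s_def)
    moreover have "1 / s \<le> 2 / d"
      using s \<open>t > 0\<close> \<open>t \<le> 1\<close> unfolding dst by (simp add: field_simps)
    moreover have "3 / (2 * d) = 3 / 4 * (2 / d)" by simp
    ultimately have C12: "S n + 3 / (2 * d) \<le> C12 n b" by linarith
    have "Q * (1 - b ^ 3) < 6 * b ^ 3"
    proof -
      have "b ^ 3 \<ge> (4 / 5) ^ 3" using b by (intro power_mono) auto
      then have b3: "b ^ 3 \<ge> 1 / 2" by (simp add: power3_eq_cube)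
      have "b * t ^ 3 \<le> b" using b \<open>t > 0\<close> \<open>t \<le> 1\<close> by (simp add: power_le_one)
      have "1 - b ^ 3 = (1 - b) * (1 + b + b\<^sup>2)"
        by (simp add: power2_eq_square power3_eq_cube algebra_simps)
      also have "\<dots> \<le> (1 - b * t ^ 3) * 3"
      proof (rule mult_mono)
        show "1 + b + b\<^sup>2 \<le> 3" using \<open>b < 1\<close> \<open>b\<^sup>2 < 1\<^sup>2\<close> by simp
        show "0 \<le> 1 + b + b\<^sup>2" using b by (intro add_nonneg_nonneg) auto
      qed (use \<open>b * t ^ 3 \<le> b\<close> \<open>b < 1\<close> in linarith)+
      finally have "Q * (1 - b ^ 3) \<le> Q * ((1 - b * t ^ 3) * 3)"
        using \<open>S n > 0\<close> d by (intro mult_left_mono) (auto simp: Q_def)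
      also have "\<dots> = 3 * (Q * (1 - b * t ^ 3))" by simp
      also have "\<dots> < 3" using key by simp
      also have "\<dots> \<le> 6 * b ^ 3" using b3 by simp
      finally show ?thesis .
    qed
    then have "S n < b ^ 3 * (S n + 3 / (2 * d))"
      using d by (simp add: Q_def field_simps)
    also have "\<dots> \<le> b ^ 3 * C12 n b"
      using C12 b by (intro mult_left_mono) auto
    finally have "S n / b < b\<^sup>2 * C12 n b"
      using b by (simp add: field_simps power2_eq_square power3_eq_cube)
    then show ?thesis using F_inverse[of b n] b by simp
  qed
qed

text \<open>The function \<open>F 4\<close> is negative at \<open>cos (pi / 4)\<close>, so a smaller \<open>b\<close> is needed. With
\<open>b = 2 / 3\<close> the terms of the nearest bodies in \<open>C21\<close> are negative, and rational bounds for the square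
roots are good enough.\<close>

lemma F_changes_sign_square:
  "F 4 (2 / 3) > 0" "F 4 (1 / (2 / 3)) < 0"
proof -
  define r where "r = sqrt (2::real)"
  define s where "s = sin (pi / 4 / 2)"
  define c where "c = cos (pi / 4 / 2)"
  define y where "y = sqrt ((13 - 6 * r) / 9)"
  have r: "1.4142 < r" "r < 1.4143"
    unfolding r_def by (rule real_less_rsqrt real_less_lsqrt; simp add: power2_eq_square)+
  have cos: "cos (pi / 4) = r / 2" by (simp add: r_def cos_45)
  have sin: "sin (pi / 4) = r / 2" by (simp add: r_def sin_45)
  have rr: "2 / r = r" by (simp add: r_def real_div_sqrt)
  have S4: "4 * S 4 = 1 + 2 * r"
  proof -
    have "sin (3 * pi / 4) = sin (pi - pi / 4)" by (rule arg_cong[of _ _ sin]) simp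
    also have "\<dots> = r / 2" by (simp only: sin_pi_minus sin)
    finally have sin': "sin (3 * pi / 4) = r / 2" .
    have "1 / sin (3 * pi / 4) = r" unfolding sin' using rr by simp
    moreover have "1 / sin (pi / 4) = r" unfolding sin using rr by simp
    ultimately show ?thesis
      using rr by (simp add: four_S numeral_eq_Suc)
  qed
  have "s > 0" using sin_half_step_pos[of 4] by (simp add: s_def)
  have s2: "s\<^sup>2 = (1 - r / 2) / 2"
  proof -
    have "r / 2 = 1 - 2 * s\<^sup>2"
      unfolding cos[symmetric] s_def using cos_double_sin[of "pi / 4 / 2"] by simp
    then show ?thesis by (simp add: field_simps)
  qed
  have c2: "c\<^sup>2 = (1 + r / 2) / 2"
  proof -
    have "r / 2 = 2 * c\<^sup>2 - 1"
      unfolding cos[symmetric] c_def using cos_double_cos[of "pi / 4 / 2"] by simp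
    then show ?thesis by (simp add: field_simps)
  qed
  have s_ge: "0.3826 \<le> s"
  proof (rule power2_le_imp_le)
    show "0.3826\<^sup>2 \<le> s\<^sup>2" unfolding s2 using r by (simp add: power2_eq_square)
  qed (use \<open>s > 0\<close> in simp)
  have c_le: "c \<le> 0.9239"
  proof (rule power2_le_imp_le)
    show "c\<^sup>2 \<le> 0.9239\<^sup>2" unfolding c2 using r by (simp add: power2_eq_square)
  qed simp
  have "y > 0" and y2: "y\<^sup>2 = (13 - 6 * r) / 9" using r by (simp_all add: y_def)
  have y_le: "y \<le> 0.7084"
  proof (rule power2_le_imp_le)
    show "y\<^sup>2 \<le> 0.7084\<^sup>2" unfolding y2 using r by (simp add: power2_eq_square)
  qed simp
  have D: "(1 + (2 / 3)\<^sup>2 - 2 * (2 / 3) * cos (pi / real 4)) powr (3 / 2) = y ^ 3"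
  proof -
    have "1 + (2 / 3)\<^sup>2 - 2 * (2 / 3) * cos (pi / real 4) = y\<^sup>2"
      unfolding y2 by (simp add: cos power2_eq_square)
    then show ?thesis using square_powr_three_halves[of y] \<open>y > 0\<close> by simp
  qed
  have y3: "y ^ 3 \<le> 0.7084 ^ 3" using y_le \<open>y > 0\<close> by (intro power_mono) auto
  have y3_pos: "y ^ 3 > 0" using \<open>y > 0\<close> by simp
  show "F 4 (2 / 3) > 0"
  proof -
    have "midpoint_sum 4 \<le> c * (1 + r)"
      using midpoints_le_S[of 4] S4 rr sin by (simp add: c_def add.commute)
    also have "\<dots> \<le> 0.9239 * 2.4143" using c_le r by (intro mult_mono) auto
    finally have "midpoint_sum 4 / (1 + 2 / 3)\<^sup>2 \<le> 0.8031" by (simp add: power2_eq_square)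
    moreover have "2 * (2 / 3 - r / 2) / y ^ 3 \<le> - 0.227"
    proof -
      have "2 * (2 / 3 - r / 2) \<le> - 0.227 * (0.7084 ^ 3)"
        using r by (simp add: power3_eq_cube)
      also have "\<dots> \<le> - 0.227 * y ^ 3" using y3 by simp
      finally show ?thesis using y3_pos by (simp add: pos_divide_le_eq)
    qed
    moreover have "C21 4 (2 / 3) \<le> 2 * (2 / 3 - r / 2) / y ^ 3 + midpoint_sum 4 / (1 + 2 / 3)\<^sup>2"
      using C21_le[of 4 "2 / 3"] unfolding D by (simp add: cos)
    ultimately show ?thesis using S4 r by (simp add: F_def)
  qed
  show "F 4 (1 / (2 / 3)) < 0"
  proof -
    have "1 / s \<le> 1 / 0.3826" using s_ge \<open>s > 0\<close> by (intro divide_left_mono) auto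
    moreover have "1 + 2 * r \<le> midpoint_sum 4 + 1 / s"
      using S_le_midpoints[of 4] S4 by (simp add: s_def)
    moreover define N where "N = 2 * (1 - 2 / 3 * (r / 2)) / y ^ 3"
    have "2.97 \<le> N"
    proof -
      have "2.97 * y ^ 3 \<le> 2.97 * 0.7084 ^ 3" using y3 by simp
      also have "\<dots> \<le> 2 * (1 - 2 / 3 * (r / 2))" using r by (simp add: power3_eq_cube)
      finally show ?thesis using y3_pos by (simp add: N_def pos_le_divide_eq)
    qed
    moreover have "N + midpoint_sum 4 / 4 \<le> C12 4 (2 / 3)"
      using C12_ge[of 4 "2 / 3"] s2 r unfolding D by (simp add: N_def cos s_def)
    ultimately have "C12 4 (2 / 3) \<ge> 3.27" using r \<open>2.97 \<le> N\<close> by simp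
    moreover have "F 4 (1 / (2 / 3)) = S 4 / (2 / 3) - (2 / 3)\<^sup>2 * C12 4 (2 / 3)"
      by (rule F_inverse) simp
    ultimately show ?thesis using S4 r by (simp add: power2_eq_square)
  qed
qed

lemma F_changes_sign:
  assumes "n \<ge> 4"
  obtains b where "0 < b" "b < 1" "F n b > 0" "F n (1 / b) < 0"
proof (cases "n = 4")
  case True
  then show ?thesis using that[of "2 / 3"] F_changes_sign_square by simp
next
  case False
  with assms have n: "n \<ge> 5" by simp
  have "0 < cos (pi / real n)" using cos_step_estimate(2)[OF n] by simp
  moreover have "cos (pi / real n) < 1"
  proof -
    have "cos (pi / real n) < cos 0"
      using n by (intro cos_monotone_0_pi) (auto simp: field_simps)
    then show ?thesis by simp
  qed
  ultimately show ?thesis using that F_changes_sign_at_cos[OF n] by blast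
qed

text \<open>A term of \<open>C21 n a\<close> is at most the inverse square of a distance, and at this radius all the distances
from a body to the other ring are at least \<open>n\<close>.\<close>

lemma F_pos_far:
  assumes n: "n \<ge> 2" and a: "a \<ge> real n + 1"
  shows "F n a > 0"
proof -
  have a1: "a > 1" using n a by simp
  have entry: "(a - c) / (1 + a\<^sup>2 - 2 * a * c) powr (3 / 2) \<le> 1 / (real n)\<^sup>2"
    if c: "- 1 \<le> c" "c \<le> 1" for c
  proof -
    define D where "D = 1 + a\<^sup>2 - 2 * a * c"
    define y where "y = sqrt D"
    have "D = (a - c)\<^sup>2 + (1 - c\<^sup>2)" by (simp add: D_def power2_eq_square algebra_simps)
    moreover have "c\<^sup>2 \<le> 1" using c by (simp add: abs_square_le_1)
    ultimately have "D \<ge> (a - c)\<^sup>2" by simp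
    then have ac: "a - c \<le> y" unfolding y_def by (rule real_le_rsqrt)
    have "D = (a - 1)\<^sup>2 + 2 * a * (1 - c)" by (simp add: D_def power2_eq_square algebra_simps)
    then have "D \<ge> (a - 1)\<^sup>2" using a1 c by simp
    moreover have "(a - 1)\<^sup>2 \<ge> (real n)\<^sup>2" using a by (intro power_mono) auto
    ultimately have Dn: "D \<ge> (real n)\<^sup>2" by simp
    moreover have "(real n)\<^sup>2 > 0" using n by simp
    ultimately have "D > 0" by linarith
    then have y: "y > 0" "y\<^sup>2 = D" by (simp_all add: y_def)
    have "(a - c) / D powr (3 / 2) = (a - c) / y ^ 3"
      using square_powr_three_halves[of y] y by simp
    also have "\<dots> \<le> y / y ^ 3" using ac y by (intro divide_right_mono) auto
    also have "\<dots> = 1 / D" using y(1) by (simp add: power2_eq_square power3_eq_cube flip: y(2))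
    also have "\<dots> \<le> 1 / (real n)\<^sup>2" using Dn \<open>(real n)\<^sup>2 > 0\<close> \<open>D > 0\<close>
      by (intro divide_left_mono mult_pos_pos) auto
    finally show ?thesis unfolding D_def .
  qed
  have "C21 n a \<le> (\<Sum>k = 1..n. 1 / (real n)\<^sup>2)"
    unfolding C21_def by (intro sum_mono entry) auto
  also have "\<dots> = 1 / real n" using n by (simp add: power2_eq_square)
  also have "\<dots> \<le> 1 / 2" using n by (intro divide_left_mono) auto
  finally have "C21 n a \<le> 1 / 2" .
  moreover have "1 / 4 * 3 \<le> S n * a" using S_ge[of n] n a by (intro mult_mono) auto
  ultimately show ?thesis by (simp add: F_def)
qed

text \<open>The rings never meet, because the angle \<open>\<theta> n k\<close> is not a multiple of \<open>2 * pi\<close>; so the denominators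
stay positive.\<close>

lemma continuous_on_F: "continuous_on {0<..} (F n)"
proof -
  have pos: "0 < 1 + a\<^sup>2 - 2 * a * cos (\<theta> n k)" if k: "k \<in> {1..n}" and a: "a > 0" for k a
  proof -
    have "sin (\<theta> n k / 2) > 0" using k by (intro sin_half_theta_pos) auto
    then have "0 < 4 * a * (sin (\<theta> n k / 2))\<^sup>2" using a by simp
    moreover have "1 + a\<^sup>2 - 2 * a * cos (\<theta> n k) = (1 - a)\<^sup>2 + 4 * a * (sin (\<theta> n k / 2))\<^sup>2"
      unfolding cos_theta by (simp add: power2_eq_square algebra_simps)
    ultimately show ?thesis using zero_le_power2[of "1 - a"] by linarith
  qed
  then show ?thesis
    unfolding F_def C21_def by (intro continuous_intros) (force dest: pos)+
qed

section \<open>Admissible radii\<close>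

text \<open>With \<open>b\<close> as in \<open>F_changes_sign\<close>, the intermediate value theorem gives a zero in \<open>(b, 1)\<close> and one
beyond \<open>1 / b\<close>; these must be \<open>z1\<close> and \<open>z2\<close>, so \<open>z1 * z2 > b * (1 / b) = 1\<close>. The sign of \<open>F n\<close> on each of the
three intervals is its sign at a sample point, \<open>b\<close>, \<open>1\<close> or a point far out, since a different
sign would produce a third zero.\<close>

lemma zeros_of_F:
  assumes n: "n \<ge> 4" and "z1 < z2" and zeros: "{a. a > 0 \<and> F n a = 0} = {z1, z2}"
  shows "0 < z1" "z1 < 1" "z1 * z2 > 1"
    and "\<And>a. a > 0 \<Longrightarrow> F n a > 0 \<longleftrightarrow> a < z1 \<or> a > z2"
proof -
  have mem: "a = z1 \<or> a = z2" if "a > 0" "F n a = 0" for a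
    using zeros that by blast
  show "0 < z1" using zeros by blast
  have "0 < z2" using \<open>0 < z1\<close> \<open>z1 < z2\<close> by simp
  have cont: "continuous_on {x..y} (F n)" if "0 < x" for x y
    using that by (intro continuous_on_subset[OF continuous_on_F]) auto
  have down: "\<exists>z. x < z \<and> z < y \<and> F n z = 0" if "0 < x" "x < y" "F n x > 0" "F n y < 0" for x y
  proof -
    have "\<exists>z\<ge>x. z \<le> y \<and> F n z = 0"
      using that cont[OF that(1), of y] by (intro IVT2') simp_all
    then obtain z where z: "x \<le> z" "z \<le> y" "F n z = 0" by blast
    moreover have "z \<noteq> x" "z \<noteq> y" using that z(3) by auto
    ultimately show ?thesis by (intro exI[of _ z]) simp
  qed
  have up: "\<exists>z. x < z \<and> z < y \<and> F n z = 0" if "0 < x" "x < y" "F n x < 0" "F n y > 0" for x y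
  proof -
    have "\<exists>z\<ge>x. z \<le> y \<and> F n z = 0"
      using that cont[OF that(1), of y] by (intro IVT') simp_all
    then obtain z where z: "x \<le> z" "z \<le> y" "F n z = 0" by blast
    moreover have "z \<noteq> x" "z \<noteq> y" using that z(3) by auto
    ultimately show ?thesis by (intro exI[of _ z]) simp
  qed
  obtain b where b: "0 < b" "b < 1" "F n b > 0" "F n (1 / b) < 0"
    using F_changes_sign[OF n] .
  have "1 < 1 / b" using b by simp
  define far where "far = real n + 1 + 1 / b"
  have far: "F n a > 0" if "a \<ge> far" for a
  proof (rule F_pos_far)
    show "a \<ge> real n + 1" using that \<open>1 < 1 / b\<close> unfolding far_def by linarith
  qed (use n in simp)
  have "1 / b < far" unfolding far_def by simp
  obtain x where x: "b < x" "x < 1" "F n x = 0"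
    using down[of b 1] b F_one_neg[of n] n by auto
  obtain y where y: "1 / b < y" "F n y = 0"
    using up[of "1 / b" far] far[of far] \<open>1 / b < far\<close> b by auto
  have "0 < x" "x < y" using x y b \<open>1 < 1 / b\<close> by linarith+
  moreover have "x = z1 \<or> x = z2" "y = z1 \<or> y = z2"
    using mem[of x] mem[of y] x y \<open>0 < x\<close> \<open>x < y\<close> by auto
  ultimately have "x = z1" "y = z2"
    using \<open>z1 < z2\<close> by linarith+
  then have z1: "b < z1" and z2: "1 / b < z2" using x y by simp_all
  show "z1 < 1" using x \<open>x = z1\<close> by simp
  have "1 < b * z2" using z2 b by (simp add: field_simps)
  also have "\<dots> \<le> z1 * z2" using z1 \<open>0 < z2\<close> by simp
  finally show "z1 * z2 > 1" .
  fix a :: real assume "a > 0"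
  consider "a < z1" | "a = z1 \<or> a = z2" | "z1 < a" "a < z2" | "z2 < a" by linarith
  then show "F n a > 0 \<longleftrightarrow> a < z1 \<or> a > z2"
  proof cases
    case 1
    have "\<not> F n a < 0"
    proof
      assume neg: "F n a < 0"
      have "a \<noteq> b" using neg b by auto
      then have "\<exists>z>0. z < z1 \<and> F n z = 0"
      proof (cases "a < b")
        case True
        then obtain z where "a < z" "z < b" "F n z = 0" using up[of a b] neg b \<open>a > 0\<close> by blast
        then show ?thesis using z1 \<open>a > 0\<close> by (intro exI[of _ z]) simp
      next
        case False
        then obtain z where "b < z" "z < a" "F n z = 0" using down[of b a] neg b \<open>a \<noteq> b\<close> by force
        then show ?thesis using 1 b by (intro exI[of _ z]) simp
      qed
      then obtain z where "z > 0" "z < z1" "F n z = 0" by blast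
      then show False using mem[of z] \<open>z1 < z2\<close> by simp
    qed
    moreover have "F n a \<noteq> 0" using mem[of a] 1 \<open>a > 0\<close> \<open>z1 < z2\<close> by auto
    ultimately show ?thesis using 1 by simp
  next
    case 2
    then have "F n a = 0" using zeros by blast
    then show ?thesis using 2 \<open>z1 < z2\<close> by auto
  next
    case 3
    have one: "F n 1 < 0" "z1 < 1" "1 < z2"
      using F_one_neg[of n] n \<open>z1 < 1\<close> z2 \<open>1 < 1 / b\<close> by auto
    have "\<not> F n a > 0"
    proof
      assume pos: "F n a > 0"
      have "a \<noteq> 1" using pos one by auto
      then have "\<exists>z>0. z1 < z \<and> z < z2 \<and> F n z = 0"
      proof (cases "a < 1")
        case True
        then obtain z where "a < z" "z < 1" "F n z = 0" using down[of a 1] pos one \<open>a > 0\<close> by blast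
        then show ?thesis using 3 one \<open>a > 0\<close> by (intro exI[of _ z]) simp
      next
        case False
        then obtain z where "1 < z" "z < a" "F n z = 0" using up[of 1 a] pos one \<open>a \<noteq> 1\<close> by force
        then show ?thesis using 3 one by (intro exI[of _ z]) simp
      qed
      then obtain z where "z > 0" "z1 < z" "z < z2" "F n z = 0" by blast
      then show False using mem[of z] by simp
    qed
    then show ?thesis using 3 by simp
  next
    case 4
    have "\<not> F n a < 0"
    proof
      assume neg: "F n a < 0"
      have "F n (max a far + 1) > 0" by (rule far) simp
      then obtain z where "a < z" "F n z = 0"
        using up[of a "max a far + 1"] neg \<open>a > 0\<close> by force
      then show False using mem[of z] 4 \<open>a > 0\<close> \<open>z1 < z2\<close> by simp
    qed
    moreover have "F n a \<noteq> 0" using mem[of a] 4 \<open>a > 0\<close> \<open>z1 < z2\<close> by auto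
    ultimately show ?thesis using 4 by simp
  qed
qed

theorem theorem3:
  fixes n :: nat and z1 z2 :: real
  assumes "n \<ge> 4"
    and "z1 < z2"
    and "{a. a > 0 \<and> F n a = 0} = {z1, z2}"
  shows "admissible n = {0<..<1 / z2} \<union> {z1<..<1 / z1} \<union> {z2<..}"
proof -
  note z = zeros_of_F[OF assms]
  have "0 < z2" using z(1) assms(2) by simp
  \<comment> \<open>here \<open>z1 * z2 > 1\<close> decides the relative position of the zeros and their inverses\<close>
  have order: "1 / z2 < z1" "z1 < 1 / z1" "1 / z1 < z2"
    using z(1-3) \<open>0 < z2\<close> by (simp_all add: field_simps power2_eq_square[symmetric] power_less_one_iff)
  have zero: "F n a = 0 \<longleftrightarrow> a = z1 \<or> a = z2" if "a > 0" for a
    using assms(3) that by blast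
  have "a \<in> admissible n \<longleftrightarrow> a \<in> {0<..<1 / z2} \<union> {z1<..<1 / z1} \<union> {z2<..}" for a
  proof (cases "a > 0")
    case True
    have inverse: "1 / a < z1 \<longleftrightarrow> 1 / z1 < a" "1 / a > z2 \<longleftrightarrow> a < 1 / z2"
        "1 / a = z1 \<longleftrightarrow> a = 1 / z1" "1 / a = z2 \<longleftrightarrow> a = 1 / z2"
      using True z(1) \<open>0 < z2\<close> by (auto simp: field_simps)
    have "a \<in> admissible n \<longleftrightarrow> (\<exists>m>0. m * F n (1 / a) = a * F n a)"
      using True assms(1) by (auto simp: admissible_def twisted_crown_iff)
    also have "\<dots> \<longleftrightarrow> sgn (F n a) = sgn (F n (1 / a))"
    proof
      assume "\<exists>m>0. m * F n (1 / a) = a * F n a"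
      then obtain m where "m > 0" "m * F n (1 / a) = a * F n a" by blast
      then have "sgn m * sgn (F n (1 / a)) = sgn a * sgn (F n a)" by (metis sgn_mult)
      then show "sgn (F n a) = sgn (F n (1 / a))" using \<open>m > 0\<close> True by simp
    next
      assume eq: "sgn (F n a) = sgn (F n (1 / a))"
      show "\<exists>m>0. m * F n (1 / a) = a * F n a"
      proof (cases "F n a = 0")
        case zero: True
        then have "F n (1 / a) = 0" using eq by (simp add: sgn_0_0)
        then show ?thesis using zero by (intro exI[of _ 1]) simp
      next
        case False
        then have "F n (1 / a) \<noteq> 0" "F n a / F n (1 / a) > 0"
          using eq by (auto simp: sgn_if zero_less_divide_iff split: if_splits)
        moreover have "a * (F n a / F n (1 / a)) > 0"
          using True \<open>F n a / F n (1 / a) > 0\<close> by (rule mult_pos_pos)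
        ultimately show ?thesis by (intro exI[of _ "a * (F n a / F n (1 / a))"] conjI) simp_all
      qed
    qed
    also have "\<dots> \<longleftrightarrow> (F n a > 0 \<longleftrightarrow> F n (1 / a) > 0) \<and> (F n a = 0 \<longleftrightarrow> F n (1 / a) = 0)"
      by (auto simp: sgn_if)
    also have "\<dots> \<longleftrightarrow> (a < z1 \<or> a > z2 \<longleftrightarrow> 1 / z1 < a \<or> a < 1 / z2)
        \<and> (a = z1 \<or> a = z2 \<longleftrightarrow> a = 1 / z1 \<or> a = 1 / z2)"
      using True by (simp add: z(4) zero inverse)
    also have "\<dots> \<longleftrightarrow> a < 1 / z2 \<or> z1 < a \<and> a < 1 / z1 \<or> z2 < a"
      using order by linarith
    finally show ?thesis using True by auto
  next
    case False
    then show ?thesis using z(1) \<open>0 < z2\<close> by (auto simp: admissible_def)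
  qed
  then show ?thesis by blast
qed

end
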